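(* Let $G$ be a finite group. If $\mathrm{anz}(G) < \frac{1}{2}$, then $G$ is supersolvable.
   Context: For a finite group $G$, $\mathrm{Irr}(G)$ denotes the set of complex irreducible characters of $G$. $\mathrm{nz}(G)$ denotes the number of zeros in the character table of $G$, i.e. the number of pairs $(\chi, C)$ with $\chi\in\mathrm{Irr}(G)$ and $C$ a conjugacy class of $G$ such that $\chi$ is $0$ on $C$. The average number of zeros of characters of $G$ is $\mathrm{anz}(G) := \mathrm{nz}(G)/|\mathrm{Irr}(G)|$. *)

theory Defs
  imports "HOL-Algebra.Elementary_Groups" "HOL-Algebra.Group_Action"
    "Jordan_Normal_Form.VS_Connect"
begin

definition supersolvable :: "('a, 'b) monoid_scheme \<Rightarrow> bool" where
  "supersolvable G \<longleftrightarrow>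
    (\<exists>(r :: nat) N. N 0 = {\<one>\<^bsub>G\<^esub>} \<and> N r = carrier G \<and> (\<forall>i\<le>r. N i \<lhd> G) \<and>
      (\<forall>i<r. N i \<subseteq> N (Suc i) \<and> cyclic_group ((G\<lparr>carrier := N (Suc i)\<rparr>) Mod N i)))"

definition conjugacy_classes :: "('a, 'b) monoid_scheme \<Rightarrow> 'a set set" where
  "conjugacy_classes G =
    orbits G (carrier G) (\<lambda>g. \<lambda>h \<in> carrier G. g \<otimes>\<^bsub>G\<^esub> h \<otimes>\<^bsub>G\<^esub> inv\<^bsub>G\<^esub> g)"

abbreviation general_linear_group :: "nat \<Rightarrow> complex mat monoid" where
  "general_linear_group n \<equiv> units_of (ring_mat TYPE(complex) n ())"

definition representation ::
    "('a, 'b) monoid_scheme \<Rightarrow> nat \<Rightarrow> ('a \<Rightarrow> complex mat) \<Rightarrow> bool" where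
  "representation G n \<rho> \<longleftrightarrow> \<rho> \<in> hom G (general_linear_group n)"

definition invariant_subspace ::
    "('a, 'b) monoid_scheme \<Rightarrow> nat \<Rightarrow> ('a \<Rightarrow> complex mat) \<Rightarrow> complex vec set \<Rightarrow> bool" where
  "invariant_subspace G n \<rho> W \<longleftrightarrow>
    subspace class_ring W (module_vec TYPE(complex) n) \<and>
    (\<forall>g \<in> carrier G. \<forall>w \<in> W. \<rho> g *\<^sub>v w \<in> W)"

definition irreducible_representation ::
    "('a, 'b) monoid_scheme \<Rightarrow> nat \<Rightarrow> ('a \<Rightarrow> complex mat) \<Rightarrow> bool" where
  "irreducible_representation G n \<rho> \<longleftrightarrow>
    representation G n \<rho> \<and> n > 0 \<and>
    (\<forall>W. invariant_subspace G n \<rho> W \<longrightarrow> W = {0\<^sub>v n} \<or> W = carrier_vec n)"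

definition mat_trace :: "complex mat \<Rightarrow> complex" where
  "mat_trace A = (\<Sum>i<dim_row A. A $$ (i, i))"

text \<open>Characters are restricted to the carrier, so that two characters that agree on the
  group are equal as HOL functions and are counted only once.\<close>

definition character ::
    "('a, 'b) monoid_scheme \<Rightarrow> ('a \<Rightarrow> complex mat) \<Rightarrow> 'a \<Rightarrow> complex" where
  "character G \<rho> = (\<lambda>g \<in> carrier G. mat_trace (\<rho> g))"

definition Irr :: "('a, 'b) monoid_scheme \<Rightarrow> ('a \<Rightarrow> complex) set" where
  "Irr G = {character G \<rho> | n \<rho>. irreducible_representation G n \<rho>}"

definition nz :: "('a, 'b) monoid_scheme \<Rightarrow> nat" where
  "nz G = card {(\<chi>, C). \<chi> \<in> Irr G \<and> C \<in> conjugacy_classes G \<and> (\<forall>g \<in> C. \<chi> g = 0)}"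

definition anz :: "('a, 'b) monoid_scheme \<Rightarrow> real" where
  "anz G = real (nz G) / real (card (Irr G))"

end

theory Submission
  imports Defs "Jordan_Normal_Form.Schur_Decomposition" "HOL-Algebra.SndIsomorphismGrp"
    "HOL-Algebra.Multiplicative_Group" "HOL-Number_Theory.Cong"
begin

text \<open>The hypothesis leaves hardly any groups. Let \<open>m\<close> and \<open>t\<close> be the numbers of linear and nonlinear
  irreducible characters. By Burnside's theorem every nonlinear character has a zero, so \<open>t < m\<close>.
  The group of linear characters acts on the nonlinear ones by multiplication; let \<open>\<chi>\<close> be nonlinear
  with an orbit of length \<open>a\<close>. It vanishes outside the common kernel of its stabilizer, which has index
  at least \<open>m / a\<close>, while every conjugacy class lies in a coset of the common kernel of all linear
  characters and so has at most \<open>\<bar>G\<bar> / m\<close> elements. Hence \<open>\<chi>\<close> vanishes on at least \<open>m - a\<close> classes,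
  and counting the zeros along orbits forces \<open>t = 0\<close>, or \<open>m = 2\<close> and \<open>t = 1\<close>. In the first case \<open>G\<close> is
  abelian. In the second case the complement of a subgroup \<open>K\<close> of index 2 is a single conjugacy class,
  so its elements are involutions that invert \<open>K\<close>, and every subgroup of \<open>K\<close> is normal in \<open>G\<close>.\<close>

section \<open>Complex matrices\<close>

text \<open>The count runs as follows. Since \<open>a \<le> t < m\<close> and \<open>a\<close>
  divides \<open>m\<close>, at most half of \<open>m\<close> is lost in \<open>m - a\<close>, so one
  orbit already has at least \<open>a * m / 2\<close> zeros, while there are fewer than
  \<open>(m + t) / 2 < m\<close> in all; hence \<open>a = 1\<close>. Then each nonlinear character
  vanishes on at least \<open>m - 1\<close> classes, and \<open>2 * t * (m - 1) < m + t\<close>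
  leaves only \<open>m = 2\<close>, \<open>t = 1\<close>. The bound 1/2 is sharp: the alternating
  group on four letters is not supersolvable and has \<open>m = 3\<close>, \<open>t = 1\<close> and
  two zeros, which turns the last inequality into an equality. The indices of the kernels are
  bounded by Bessel's inequality, a consequence of orthonormality. Two points lie deeper. Burnside's
  theorem is arithmetic: a product of character values has to be an integer. And the case
  \<open>t = 0\<close> needs enough irreducible representations to detect a nontrivial normal
  subgroup, a completeness statement beyond orthonormality; a representation of minimal dimension
  supplies it.\<close>

lemma mat_trace_comm:
  assumes "A \<in> carrier_mat n m" and "B \<in> carrier_mat m n"
  shows "mat_trace (A * B) = mat_trace (B * A)"
proof -
  have "mat_trace (A * B) = (\<Sum>i<n. \<Sum>j<m. A $$ (i, j) * B $$ (j, i))"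
    using assms by (auto simp: mat_trace_def scalar_prod_def atLeast0LessThan intro!: sum.cong)
  also have "\<dots> = (\<Sum>j<m. \<Sum>i<n. B $$ (j, i) * A $$ (i, j))"
    by (subst sum.swap) (simp add: mult.commute)
  also have "\<dots> = mat_trace (B * A)"
    using assms by (auto simp: mat_trace_def scalar_prod_def atLeast0LessThan intro!: sum.cong)
  finally show ?thesis .
qed

lemma mat_trace_conj:
  assumes "P \<in> carrier_mat n n" "Q \<in> carrier_mat n n" "A \<in> carrier_mat n n" "Q * P = 1\<^sub>m n"
  shows "mat_trace (P * A * Q) = mat_trace A"
proof -
  have "mat_trace (P * A * Q) = mat_trace (Q * (P * A))"
    using assms by (intro mat_trace_comm) auto
  also have "Q * (P * A) = Q * P * A"
    using assms by (intro assoc_mult_mat[symmetric])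
  also have "\<dots> = A" using assms by simp
  finally show ?thesis .
qed

lemma mat_trace_one [simp]: "mat_trace (1\<^sub>m n) = of_nat n"
  by (simp add: mat_trace_def)

lemma mat_trace_smult: "A \<in> carrier_mat n n \<Longrightarrow> mat_trace (c \<cdot>\<^sub>m A) = c * mat_trace A"
  by (auto simp: mat_trace_def sum_distrib_left)

lemma upper_triangular_mult:
  fixes A B :: "complex mat"
  assumes A: "A \<in> carrier_mat n n" "upper_triangular A"
    and B: "B \<in> carrier_mat n n" "upper_triangular B"
  shows "upper_triangular (A * B)"
    and "i < n \<Longrightarrow> (A * B) $$ (i, i) = A $$ (i, i) * B $$ (i, i)"
proof -
  have *: "(A * B) $$ (i, j) = (\<Sum>k<n. A $$ (i, k) * B $$ (k, j))" if "i < n" "j < n" for i j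
    using that A B by (auto simp: scalar_prod_def atLeast0LessThan intro!: sum.cong)
  show "upper_triangular (A * B)"
  proof (rule upper_triangularI)
    fix i j assume "j < i" "i < dim_row (A * B)"
    then have ij: "j < i" "i < n" using A by auto
    have "A $$ (i, k) * B $$ (k, j) = 0" if "k < n" for k
      using that ij upper_triangularD[OF A(2), of k i] upper_triangularD[OF B(2), of j k] A B
      by (cases "k < i") auto
    then have "(\<Sum>k<n. A $$ (i, k) * B $$ (k, j)) = 0" by (intro sum.neutral) auto
    then show "(A * B) $$ (i, j) = 0" using * ij by simp
  qed
  show "(A * B) $$ (i, i) = A $$ (i, i) * B $$ (i, i)" if "i < n"
  proof -
    have "A $$ (i, k) * B $$ (k, i) = (if k = i then A $$ (i, i) * B $$ (i, i) else 0)" if "k < n" for k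
      using that \<open>i < n\<close> upper_triangularD[OF A(2), of k i] upper_triangularD[OF B(2), of i k] A B
      by (cases k i rule: linorder_cases) auto
    then have "(\<Sum>k<n. A $$ (i, k) * B $$ (k, i)) = (\<Sum>k<n. if k = i then A $$ (i, i) * B $$ (i, i) else 0)"
      by (intro sum.cong) auto
    also have "\<dots> = A $$ (i, i) * B $$ (i, i)"
      using \<open>i < n\<close> by simp
    finally show ?thesis using * that by simp
  qed
qed

lemma upper_triangular_pow:
  fixes A :: "complex mat"
  assumes A: "A \<in> carrier_mat n n" "upper_triangular A"
  shows "upper_triangular (A ^\<^sub>m k) \<and> (\<forall>i<n. (A ^\<^sub>m k) $$ (i, i) = (A $$ (i, i)) ^ k)"
proof (induction k)
  case 0
  then show ?case using A by (auto simp: upper_triangular_def)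
next
  case (Suc k)
  then show ?case using upper_triangular_mult[of "A ^\<^sub>m k" n A] A by auto
qed

text \<open>By Schur decomposition \<open>A\<close> is similar to a triangular \<open>B\<close>, and
  the diagonal of \<open>B ^\<^sub>m k\<close> consists of the powers of the diagonal of
  \<open>B\<close>. One family \<open>f\<close> of eigenvalues serves all \<open>k\<close> at once;
  this uniformity later turns Galois conjugation of character values into a power map on the
  group.\<close>

lemma finite_order_mat_trace_pow:
  fixes A :: "complex mat"
  assumes A: "A \<in> carrier_mat n n" and pow: "A ^\<^sub>m N = 1\<^sub>m n"
  shows "\<exists>f. (\<forall>i<n. f i ^ N = 1) \<and> (\<forall>k. mat_trace (A ^\<^sub>m k) = (\<Sum>i<n. f i ^ k))"
proof -
  obtain es where "char_poly A = (\<Prod>a\<leftarrow>es. [:- a, 1:])"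
    using char_poly_factorized[OF A] by blast
  then obtain B where B: "B \<in> carrier_mat n n" "upper_triangular B" and sim: "similar_mat A B"
    using schur_decomposition_exists[OF A] by blast
  then obtain P Q where wit: "similar_mat_wit A B P Q" unfolding similar_mat_def by blast
  note w = similar_mat_wit_pow[OF wit]
  have tr: "mat_trace (A ^\<^sub>m k) = (\<Sum>i<n. (B $$ (i, i)) ^ k)" for k
  proof -
    have "A ^\<^sub>m k = P * B ^\<^sub>m k * Q" and "P \<in> carrier_mat n n" "Q \<in> carrier_mat n n" "Q * P = 1\<^sub>m n"
      using similar_mat_witD2[OF A wit] similar_mat_witD(3)[OF refl w[of k]] by auto
    then have "mat_trace (A ^\<^sub>m k) = mat_trace (B ^\<^sub>m k)"
      using B by (simp add: mat_trace_conj)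
    then show ?thesis using upper_triangular_pow[OF B, of k] B by (auto simp: mat_trace_def)
  qed
  have "B ^\<^sub>m N = 1\<^sub>m n"
  proof -
    have c: "P \<in> carrier_mat n n" "Q \<in> carrier_mat n n" and QP: "Q * P = 1\<^sub>m n"
      and "1\<^sub>m n = P * B ^\<^sub>m N * Q"
      using similar_mat_witD2[OF A wit] pow similar_mat_witD(3)[OF refl w[of N]] by auto
    have BN: "B ^\<^sub>m N \<in> carrier_mat n n" using B by simp
    have "Q = Q * (P * B ^\<^sub>m N * Q)" using \<open>1\<^sub>m n = _\<close>[symmetric] c by simp
    also have "\<dots> = Q * (P * (B ^\<^sub>m N * Q))"
      using assoc_mult_mat[OF c(1) BN c(2)] by simp
    also have "\<dots> = Q * P * (B ^\<^sub>m N * Q)"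
      using c BN by (intro assoc_mult_mat[symmetric, of _ n n _ n _ n]) auto
    also have "\<dots> = B ^\<^sub>m N * Q"
      using QP left_mult_one_mat[OF mult_carrier_mat[OF BN c(2)]] by simp
    finally have "Q * P = B ^\<^sub>m N * Q * P" by simp
    also have "\<dots> = B ^\<^sub>m N * (Q * P)" using c BN by (intro assoc_mult_mat)
    finally show ?thesis using QP right_mult_one_mat[OF BN] by simp
  qed
  then have "(B $$ (i, i)) ^ N = 1" if "i < n" for i
    using upper_triangular_pow[OF B, of N] that by auto
  with tr show ?thesis by (intro exI[of _ "\<lambda>i. B $$ (i, i)"]) simp
qed

section \<open>Subspaces and invertibility in terms of rectangular matrices\<close>

lemma subspace_vec_iff:
  "VectorSpace.subspace class_ring W (module_vec TYPE(complex) n) \<longleftrightarrow>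
    W \<subseteq> carrier_vec n \<and> 0\<^sub>v n \<in> W \<and> (\<forall>v\<in>W. \<forall>w\<in>W. v + w \<in> W) \<and> (\<forall>c. \<forall>v\<in>W. c \<cdot>\<^sub>v v \<in> W)"
  unfolding VectorSpace.subspace_def submodule_def
  using vec_vs[of n, where 'a = complex] vec_module[of n, where 'a = complex]
  by (auto simp: module_vec_simps class_ring_simps)

text \<open>If \<open>n < k\<close>, padding \<open>P\<close> with zero rows to a square matrix
  makes it singular, and a kernel vector of the padded matrix is killed by \<open>P\<close> as
  well.\<close>

lemma injective_mat_dim_le:
  fixes P :: "complex mat"
  assumes P: "P \<in> carrier_mat n k"
    and inj: "\<And>v. v \<in> carrier_vec k \<Longrightarrow> P *\<^sub>v v = 0\<^sub>v n \<Longrightarrow> v = 0\<^sub>v k"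
  shows "k \<le> n"
proof (rule ccontr)
  assume "\<not> k \<le> n"
  then have nk: "n < k" by simp
  define A where "A = mat k k (\<lambda>(i, j). if i < n then P $$ (i, j) else 0)"
  have A: "A \<in> carrier_mat k k" by (simp add: A_def)
  have "row A n = 0\<^sub>v k" using nk by (auto simp: A_def)
  then have "det A = 0"
  proof -
    have "transpose_mat A *\<^sub>v unit_vec k n = 0\<^sub>v k"
      using nk A by (auto simp: A_def scalar_prod_def unit_vec_def intro!: sum.neutral)
    moreover have "unit_vec k n \<noteq> (0\<^sub>v k :: complex vec)" using nk by simp
    ultimately have "det (transpose_mat A) = 0"
      using A by (subst det_0_iff_vec_prod_zero[of _ k]) (auto intro!: exI[of _ "unit_vec k n"])
    then show ?thesis using det_transpose[OF A] by simp
  qed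
  then obtain v where v: "v \<in> carrier_vec k" "v \<noteq> 0\<^sub>v k" "A *\<^sub>v v = 0\<^sub>v k"
    using det_0_iff_vec_prod_zero[OF A] by blast
  have "P *\<^sub>v v = 0\<^sub>v n"
  proof (rule eq_vecI)
    fix i assume "i < dim_vec (0\<^sub>v n)"
    then have i: "i < n" by simp
    have "row A i = row P i" using i nk P by (auto simp: A_def)
    then have "(P *\<^sub>v v) $ i = (A *\<^sub>v v) $ i" using i nk P A by simp
    then show "(P *\<^sub>v v) $ i = 0\<^sub>v n $ i" using v i nk by simp
  qed (use P in auto)
  with inj v show False by blast
qed

lemma mat_eq_0_iff_mult_vec:
  fixes A :: "complex mat"
  assumes "A \<in> carrier_mat n m" and "\<And>v. v \<in> carrier_vec m \<Longrightarrow> A *\<^sub>v v = 0\<^sub>v n"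
  shows "A = 0\<^sub>m n m"
proof (rule eq_matI)
  fix i j assume ij: "i < dim_row (0\<^sub>m n m)" "j < dim_col (0\<^sub>m n m)"
  have "(A *\<^sub>v unit_vec m j) $ i = A $$ (i, j)" using ij assms(1) by simp
  then show "A $$ (i, j) = 0\<^sub>m n m $$ (i, j)" using assms(2)[of "unit_vec m j"] ij by simp
qed (use assms in auto)

lemma surjective_mat_right_inverse:
  fixes A :: "complex mat"
  assumes A: "A \<in> carrier_mat n m"
    and surj: "\<And>w. w \<in> carrier_vec n \<Longrightarrow> \<exists>v\<in>carrier_vec m. A *\<^sub>v v = w"
  shows "\<exists>X\<in>carrier_mat m n. A * X = 1\<^sub>m n"
proof -
  define c where "c j = (SOME v. v \<in> carrier_vec m \<and> A *\<^sub>v v = unit_vec n j)" for j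
  have c: "c j \<in> carrier_vec m" "A *\<^sub>v c j = unit_vec n j" for j
    using someI_ex[of "\<lambda>v. v \<in> carrier_vec m \<and> A *\<^sub>v v = unit_vec n j"] surj[of "unit_vec n j"]
    by (auto simp: c_def)
  define X where "X = mat m n (\<lambda>(i, j). c j $ i)"
  have col: "col X j = c j" if "j < n" for j
    using that carrier_vecD[OF c(1)[of j]] by (intro eq_vecI) (auto simp: X_def)
  have "A * X = 1\<^sub>m n"
  proof (rule eq_matI)
    fix i j assume ij: "i < dim_row (1\<^sub>m n)" "j < dim_col (1\<^sub>m n)"
    have "(A * X) $$ (i, j) = (A *\<^sub>v c j) $ i" using ij A col by (simp add: X_def)
    then show "(A * X) $$ (i, j) = 1\<^sub>m n $$ (i, j)" using c ij by simp
  qed (use A in \<open>auto simp: X_def\<close>)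
  then show ?thesis by (auto simp: X_def)
qed

text \<open>Surjectivity gives a right inverse \<open>X\<close>, which is injective; comparing
  dimensions for \<open>A\<close> and for \<open>X\<close> makes \<open>A\<close> square, and there
  a right inverse is two-sided.\<close>

lemma bijective_mat_inverse:
  fixes A :: "complex mat"
  assumes A: "A \<in> carrier_mat n m"
    and inj: "\<And>v. v \<in> carrier_vec m \<Longrightarrow> A *\<^sub>v v = 0\<^sub>v n \<Longrightarrow> v = 0\<^sub>v m"
    and surj: "\<And>w. w \<in> carrier_vec n \<Longrightarrow> \<exists>v\<in>carrier_vec m. A *\<^sub>v v = w"
  shows "n = m \<and> (\<exists>X\<in>carrier_mat m n. A * X = 1\<^sub>m n \<and> X * A = 1\<^sub>m m)"
proof -
  obtain X where X: "X \<in> carrier_mat m n" "A * X = 1\<^sub>m n"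
    using surjective_mat_right_inverse[OF A surj] by blast
  have "n \<le> m"
  proof (rule injective_mat_dim_le[OF X(1)])
    fix v :: "complex vec" assume v: "v \<in> carrier_vec n" "X *\<^sub>v v = 0\<^sub>v m"
    have "v = (A * X) *\<^sub>v v" using v X by simp
    also have "\<dots> = A *\<^sub>v (X *\<^sub>v v)" using v X A by (intro assoc_mult_mat_vec) auto
    also have "\<dots> = A *\<^sub>v 0\<^sub>v m" using v by simp
    also have "\<dots> = 0\<^sub>v n" using A by (intro eq_vecI) auto
    finally show "v = 0\<^sub>v n" .
  qed
  with injective_mat_dim_le[OF A inj] have "n = m" by simp
  with mat_mult_left_right_inverse[of A n X] A X show ?thesis by auto
qed

text \<open>The columns of \<open>P\<close> are a basis of \<open>W\<close>. Among the injective
  matrices with range inside \<open>W\<close>, one with the greatest number of columns has range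
  \<open>W\<close>, since a missed vector could be appended as a further column.\<close>

lemma subspace_is_range_of_injective_mat:
  fixes W :: "complex vec set"
  assumes W: "VectorSpace.subspace class_ring W (module_vec TYPE(complex) n)"
  shows "\<exists>k P. P \<in> carrier_mat n k \<and> W = (\<lambda>v. P *\<^sub>v v) ` carrier_vec k \<and>
    (\<forall>v\<in>carrier_vec k. P *\<^sub>v v = 0\<^sub>v n \<longrightarrow> v = 0\<^sub>v k)"
proof -
  note W' = W[unfolded subspace_vec_iff]
  define good where "good k P \<longleftrightarrow> P \<in> carrier_mat n k \<and> (\<lambda>v. P *\<^sub>v v) ` carrier_vec k \<subseteq> W \<and>
    (\<forall>v\<in>carrier_vec k. P *\<^sub>v v = 0\<^sub>v n \<longrightarrow> v = 0\<^sub>v k)" for k P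
  have "0\<^sub>m n 0 *\<^sub>v v = 0\<^sub>v n" if "v \<in> carrier_vec 0" for v :: "complex vec"
    using that by (intro eq_vecI) (auto simp: scalar_prod_def)
  then have "good 0 (0\<^sub>m n 0)"
    using W' by (auto simp: good_def)
  moreover have "\<forall>k. (\<exists>P. good k P) \<longrightarrow> k \<le> n"
    by (auto simp: good_def intro: injective_mat_dim_le)
  ultimately obtain k where k: "\<exists>P. good k P" "\<And>k'. \<exists>P. good k' P \<Longrightarrow> k' \<le> k"
    using Greatest_le_nat[of "\<lambda>k. \<exists>P. good k P" _ n] GreatestI_nat[of "\<lambda>k. \<exists>P. good k P" 0 n]
    by blast
  then obtain P where P: "good k P" by blast
  then have Pc: "P \<in> carrier_mat n k" by (simp add: good_def)
  have "W \<subseteq> (\<lambda>v. P *\<^sub>v v) ` carrier_vec k"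
  proof
    fix w assume w: "w \<in> W"
    then have wc: "w \<in> carrier_vec n" using W' by auto
    show "w \<in> (\<lambda>v. P *\<^sub>v v) ` carrier_vec k"
    proof (rule ccontr)
      assume not: "w \<notin> (\<lambda>v. P *\<^sub>v v) ` carrier_vec k"
      define P' where "P' = mat n (Suc k) (\<lambda>(i, j). if j < k then P $$ (i, j) else w $ i)"
      have eq: "P' *\<^sub>v v = P *\<^sub>v vec k (($) v) + (v $ k) \<cdot>\<^sub>v w" if v: "v \<in> carrier_vec (Suc k)" for v
        using v Pc wc by (intro eq_vecI) (auto simp: P'_def scalar_prod_def mult.commute intro!: sum.cong)
      have "good (Suc k) P'"
        unfolding good_def
      proof (intro conjI ballI impI)
        show "P' \<in> carrier_mat n (Suc k)" by (simp add: P'_def)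
        show "(\<lambda>v. P' *\<^sub>v v) ` carrier_vec (Suc k) \<subseteq> W"
        proof (rule image_subsetI)
          fix v :: "complex vec" assume v: "v \<in> carrier_vec (Suc k)"
          have "P *\<^sub>v vec k (($) v) \<in> W" using P by (auto simp: good_def)
          then show "P' *\<^sub>v v \<in> W" using eq[OF v] W' w by auto
        qed
        fix v :: "complex vec" assume v: "v \<in> carrier_vec (Suc k)" "P' *\<^sub>v v = 0\<^sub>v n"
        define u where "u = vec k (($) v)"
        have u: "u \<in> carrier_vec k" by (simp add: u_def)
        have e: "P *\<^sub>v u + (v $ k) \<cdot>\<^sub>v w = 0\<^sub>v n" using eq[OF v(1)] v(2) by (simp add: u_def)
        \<comment> \<open>A nonzero last coordinate would let the relation be solved for
          \<open>w\<close>, placing it in the range of \<open>P\<close>.\<close>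
        have vk: "v $ k = 0"
        proof (rule ccontr)
          assume nz: "v $ k \<noteq> 0"
          have "w = P *\<^sub>v ((- inverse (v $ k)) \<cdot>\<^sub>v u)"
          proof (rule eq_vecI)
            fix i assume "i < dim_vec (P *\<^sub>v ((- inverse (v $ k)) \<cdot>\<^sub>v u))"
            then have i: "i < n" using Pc by simp
            have "(P *\<^sub>v u) $ i + v $ k * w $ i = 0"
              using arg_cong[OF e, of "\<lambda>x. x $ i"] i Pc wc u by simp
            then have "w $ i = - inverse (v $ k) * (P *\<^sub>v u) $ i"
              using nz by (simp add: field_simps eq_neg_iff_add_eq_0)
            then show "w $ i = (P *\<^sub>v ((- inverse (v $ k)) \<cdot>\<^sub>v u)) $ i"
              using i Pc u by (simp add: mult_mat_vec[of _ n k])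
          qed (use wc Pc in auto)
          with not u show False by auto
        qed
        have "P *\<^sub>v u = P *\<^sub>v u + (v $ k) \<cdot>\<^sub>v w"
          using vk wc Pc by (intro eq_vecI) auto
        with e have "P *\<^sub>v u = 0\<^sub>v n" by simp
        with P u have "u = 0\<^sub>v k" by (auto simp: good_def)
        show "v = 0\<^sub>v (Suc k)"
        proof (rule eq_vecI)
          fix i assume "i < dim_vec (0\<^sub>v (Suc k))"
          then have i: "i < Suc k" by simp
          show "v $ i = 0\<^sub>v (Suc k) $ i"
            using i vk arg_cong[OF \<open>u = 0\<^sub>v k\<close>, of "\<lambda>x. x $ i"] by (cases "i = k") (auto simp: u_def)
        qed (use v in auto)
      qed
      then show False using k(2)[of "Suc k"] by auto
    qed
  qed
  with P show ?thesis by (auto simp: good_def)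
qed

lemma smult_mat_mult_vec:
  fixes A :: "complex mat"
  assumes "A \<in> carrier_mat n m" and "v \<in> carrier_vec m"
  shows "(c \<cdot>\<^sub>m A) *\<^sub>v v = c \<cdot>\<^sub>v (A *\<^sub>v v)"
  using assms by (intro eq_vecI) (auto simp: scalar_prod_def sum_distrib_left mult.assoc)

section \<open>Integrality of Galois invariant sums of roots of unity\<close>

abbreviation root_cis :: "nat \<Rightarrow> complex" where
  "root_cis n \<equiv> cis (2 * pi / real n)"

lemma root_cis_pow_self: "n > 0 \<Longrightarrow> root_cis n ^ n = 1"
  by (simp add: DeMoivre)

lemma root_cis_pow_mod:
  assumes n: "n > 0"
  shows "root_cis n ^ (k mod n) = root_cis n ^ k"
proof -
  have "root_cis n ^ k = root_cis n ^ (n * (k div n) + k mod n)" by simp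
  also have "\<dots> = root_cis n ^ (k mod n)"
    unfolding power_add power_mult root_cis_pow_self[OF n] by simp
  finally show ?thesis ..
qed

lemma root_cis_quotient_pow:
  assumes "n > 0" "g dvd n"
  shows "root_cis n ^ (g * i) = root_cis (n div g) ^ i"
proof -
  have "g > 0" using assms dvd_pos_nat by blast
  then show ?thesis using assms by (auto simp: DeMoivre real_of_nat_div field_simps)
qed

lemma root_of_unity_cis:
  fixes x :: complex
  assumes "n > 0" "x ^ n = 1"
  shows "\<exists>e. x = root_cis n ^ e"
proof -
  have "x \<in> (\<lambda>k. cis (2 * pi * real k / real n)) ` {..<n}"
    using bij_betw_roots_unity[OF assms(1)] assms(2) unfolding bij_betw_def by auto
  then obtain k where "x = cis (2 * pi * real k / real n)" by blast
  then show ?thesis by (auto simp: DeMoivre mult_ac intro!: exI[of _ k])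
qed

lemma sum_root_cis_pow_Ints:
  assumes "n > 0"
  shows "(\<Sum>j<n. root_cis n ^ (j * k)) \<in> \<int>"
proof (cases "root_cis n ^ k = 1")
  case True
  then have "root_cis n ^ (j * k) = 1" for j by (metis mult.commute power_mult power_one)
  then show ?thesis by simp
next
  case False
  have "(\<Sum>j<n. root_cis n ^ (j * k)) = (\<Sum>j<n. (root_cis n ^ k) ^ j)"
    by (simp add: power_mult[symmetric] mult.commute)
  also have "\<dots> = ((root_cis n ^ k) ^ n - 1) / (root_cis n ^ k - 1)"
    using False by (rule geometric_sum)
  also have "(root_cis n ^ k) ^ n = 1"
    using root_cis_pow_self[OF assms] by (metis mult.commute power_mult power_one)
  finally show ?thesis by simp
qed

text \<open>Sorting the full sum over \<open>j < n\<close> by \<open>g = gcd j n\<close> splits it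
  into the same kind of sum for each \<open>n div g\<close>. The part \<open>g = 1\<close> is the
  one wanted, the others are integers by induction, and the full sum is geometric.\<close>

lemma ramanujan_sum_Ints:
  "n > 0 \<Longrightarrow> (\<Sum>j | j < n \<and> coprime j n. root_cis n ^ (j * k)) \<in> \<int>"
proof (induction n rule: less_induct)
  case (less n)
  let ?S = "\<lambda>n. \<Sum>j | j < n \<and> coprime j n. root_cis n ^ (j * k)"
  let ?D = "{g. g dvd n}"
  have fin: "finite ?D" using less.prems by simp
  have "(\<Sum>j<n. root_cis n ^ (j * k)) = (\<Sum>g\<in>?D. \<Sum>j | j \<in> {..<n} \<and> gcd j n = g. root_cis n ^ (j * k))"
    using fin by (intro sum.group[symmetric]) auto
  also have "\<dots> = (\<Sum>g\<in>?D. ?S (n div g))"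
  proof (rule sum.cong[OF refl])
    fix g assume "g \<in> ?D"
    then have g: "g dvd n" "g > 0" using less.prems by (auto intro: Nat.gr0I)
    then obtain m where n: "n = g * m" by blast
    have m: "m > 0" "n div g = m" using n g less.prems by auto
    show "(\<Sum>j | j \<in> {..<n} \<and> gcd j n = g. root_cis n ^ (j * k)) = ?S (n div g)"
    proof (rule sum.reindex_bij_witness[where i = "\<lambda>i. g * i" and j = "\<lambda>j. j div g"])
      fix j assume j: "j \<in> {j. j \<in> {..<n} \<and> gcd j n = g}"
      then have gj: "g dvd j" by auto
      then obtain i where i: "j = g * i" by blast
      show "g * (j div g) = j" using gj by simp
      show "j div g \<in> {j. j < n div g \<and> coprime j (n div g)}"
        using j g m i by (auto simp: n gcd_mult_left coprime_iff_gcd_eq_1)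
      show "root_cis (n div g) ^ (j div g * k) = root_cis n ^ (j * k)"
        using root_cis_quotient_pow[OF less.prems g(1), of "i * k"] i g by (simp add: mult.assoc)
    next
      fix i assume i: "i \<in> {j. j < n div g \<and> coprime j (n div g)}"
      show "g * i div g = i" using g by simp
      show "g * i \<in> {j. j \<in> {..<n} \<and> gcd j n = g}"
        using i g m by (auto simp: n gcd_mult_left coprime_iff_gcd_eq_1)
    qed
  qed
  also have "\<dots> = ?S n + (\<Sum>g\<in>?D - {1}. ?S (n div g))"
    using fin by (subst sum.remove[of _ 1]) auto
  finally have "?S n = (\<Sum>j<n. root_cis n ^ (j * k)) - (\<Sum>g\<in>?D - {1}. ?S (n div g))"
    by (simp add: algebra_simps)
  moreover have "?S (n div g) \<in> \<int>" if "g \<in> ?D - {1}" for g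
  proof -
    have "g > 1" using that less.prems by (cases g) auto
    then show ?thesis
      using that less.prems by (intro less.IH) (auto simp: div_greater_zero_iff dvd_imp_le)
  qed
  ultimately show ?case
    using sum_root_cis_pow_Ints[OF less.prems, of k] by (metis (no_types, lifting) Ints_diff Ints_sum)
qed

text \<open>Multiplication by the value \<open>\<alpha>\<close> maps the powers
  \<open>z ^ i\<close>, \<open>i < n\<close>, to integer combinations of themselves once exponents
  are reduced modulo \<open>n\<close>; \<open>M\<close> records these. So \<open>\<alpha>\<close> is
  an eigenvalue of an integer matrix and a root of its monic characteristic polynomial.\<close>

lemma poly_root_cis_algebraic_int:
  fixes q :: "int poly"
  assumes n: "n > 0"
  shows "algebraic_int (poly (of_int_poly q) (root_cis n))"
proof -
  define z where "z = root_cis n"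
  define \<alpha> where "\<alpha> = poly (of_int_poly q) z"
  define M where "M = mat n n (\<lambda>(i, j). \<Sum>k | k \<le> degree q \<and> (i + k) mod n = j. Polynomial.coeff q k)"
  define v where "v = vec n (\<lambda>i. z ^ i)"
  have M: "M \<in> carrier_mat n n" by (simp add: M_def)
  have "map_mat of_int M *\<^sub>v v = \<alpha> \<cdot>\<^sub>v v"
  proof (rule eq_vecI)
    fix i assume "i < dim_vec (\<alpha> \<cdot>\<^sub>v v)"
    then have i: "i < n" by (simp add: v_def)
    have "(map_mat of_int M *\<^sub>v v) $ i
        = (\<Sum>j<n. (\<Sum>k | k \<in> {..degree q} \<and> (i + k) mod n = j. of_int (Polynomial.coeff q k) * z ^ j))"
      using i by (simp add: M_def v_def scalar_prod_def atLeast0LessThan sum_distrib_right)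
    also have "\<dots> = (\<Sum>j<n. (\<Sum>k | k \<in> {..degree q} \<and> (i + k) mod n = j. of_int (Polynomial.coeff q k) * z ^ (i + k)))"
      using root_cis_pow_mod[OF n] by (intro sum.cong refl) (auto simp: z_def)
    also have "\<dots> = (\<Sum>k\<le>degree q. of_int (Polynomial.coeff q k) * z ^ (i + k))"
      using n by (intro sum.group) auto
    also have "\<dots> = \<alpha> * z ^ i"
      by (simp add: \<alpha>_def poly_altdef power_add sum_distrib_left sum_distrib_right mult_ac)
    finally show "(map_mat of_int M *\<^sub>v v) $ i = (\<alpha> \<cdot>\<^sub>v v) $ i" using i by (simp add: v_def)
  qed (simp add: v_def M_def)
  moreover have "v \<noteq> 0\<^sub>v n"
  proof
    assume "v = 0\<^sub>v n"
    then have "v $ 0 = 0" using n by simp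
    then show False using n by (simp add: v_def)
  qed
  ultimately have "eigenvalue (map_mat of_int M) \<alpha>"
    unfolding eigenvalue_def eigenvector_def using M by (intro exI[of _ v]) (simp add: v_def)
  moreover have "map_mat of_int M \<in> carrier_mat n n" using M by simp
  ultimately have "poly (char_poly (map_mat of_int M)) \<alpha> = 0"
    using eigenvalue_root_char_poly by blast
  then have "poly (of_int_poly (char_poly M)) \<alpha> = 0"
    by (simp add: of_int_hom.char_poly_hom[OF M])
  moreover have "lead_coeff (char_poly M) = 1"
    using degree_monic_char_poly[OF M] by simp
  ultimately show ?thesis
    unfolding algebraic_int_altdef_ipoly \<alpha>_def z_def by blast
qed

text \<open>Averaging over the conjugates expresses the value through Ramanujan sums, so it is rational;
  this avoids the irreducibility of cyclotomic polynomials.\<close>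

lemma galois_invariant_Ints:
  fixes q :: "int poly"
  assumes n: "n > 0"
    and inv: "\<And>j. coprime j n \<Longrightarrow>
      poly (of_int_poly q) (root_cis n ^ j) = poly (of_int_poly q) (root_cis n)"
  shows "poly (of_int_poly q) (root_cis n) \<in> \<int>"
proof (rule rational_algebraic_int_is_int[OF poly_root_cis_algebraic_int[OF n]])
  let ?\<alpha> = "poly (of_int_poly q) (root_cis n)"
  let ?U = "{j. j < n \<and> coprime j n}"
  have "of_nat (card ?U) * ?\<alpha> = (\<Sum>j\<in>?U. poly (of_int_poly q) (root_cis n ^ j))"
    using inv by simp
  also have "\<dots> = (\<Sum>k\<le>degree q. of_int (Polynomial.coeff q k) * (\<Sum>j\<in>?U. root_cis n ^ (j * k)))"
    by (simp add: poly_altdef power_mult[symmetric] sum_distrib_left) (rule sum.swap)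
  also have "\<dots> \<in> \<int>"
    by (intro Ints_sum) (rule Ints_mult[OF Ints_of_int ramanujan_sum_Ints[OF n]])
  finally have "of_nat (card ?U) * ?\<alpha> \<in> \<int>" .
  moreover have "card ?U > 0"
  proof -
    \<comment> \<open>The residue \<open>1 mod n\<close> covers \<open>n = 1\<close>, where
      \<open>?U\<close> is \<open>{0}\<close>.\<close>
    have "1 mod n \<in> ?U" using n by (cases "n = 1") auto
    then show ?thesis by (auto simp: card_gt_0_iff)
  qed
  ultimately have "of_nat (card ?U) * ?\<alpha> / of_nat (card ?U) \<in> \<rat>"
    by (intro Rats_divide) (auto elim: Ints_cases)
  moreover have "of_nat (card ?U) * ?\<alpha> / of_nat (card ?U) = ?\<alpha>"
    by (rule nonzero_mult_div_cancel_left) (use \<open>card ?U > 0\<close> in \<open>metis less_irrefl of_nat_eq_0_iff\<close>)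
  ultimately show "?\<alpha> \<in> \<rat>" by metis
qed

text \<open>A form of the arithmetic-geometric mean inequality, from \<open>ln x \<le> x - 1\<close>
  summed over \<open>S\<close>.\<close>

lemma card_le_sum_if_prod_ge_1:
  fixes x :: "'a \<Rightarrow> real"
  assumes fin: "finite S" and pos: "\<And>s. s \<in> S \<Longrightarrow> x s > 0" and "prod x S \<ge> 1"
  shows "real (card S) \<le> sum x S"
proof -
  have "0 \<le> ln (prod x S)" using assms by simp
  also have "\<dots> = (\<Sum>s\<in>S. ln (x s))"
    using fin pos by (intro ln_prod) (auto, metis less_irrefl)
  also have "\<dots> \<le> (\<Sum>s\<in>S. x s - 1)"
    using pos by (intro sum_mono ln_le_minus_one)
  finally show ?thesis by (simp add: sum_subtractf)
qed

section \<open>Supersolvability criteria\<close>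

text \<open>One link of a normal series, described inside \<open>G\<close> by a generator modulo
  \<open>H\<close>. As a relation it makes a whole series a path in the reflexive transitive
  closure, so series can be concatenated without handling indices.\<close>

definition (in group) cyclic_step :: "'a set \<Rightarrow> 'a set \<Rightarrow> bool" where
  "cyclic_step H K \<longleftrightarrow> H \<lhd> G \<and> K \<lhd> G \<and>
    (\<exists>a\<in>carrier G. K = H <#> {a [^] n | n. n \<in> (UNIV :: int set)})"

text \<open>The coset of \<open>a\<close> generates the quotient, because the factor from
  \<open>H\<close> in an element of \<open>K\<close> is absorbed by its coset.\<close>

lemma (in group) cyclic_step_quotient:
  assumes "cyclic_step H K"
  shows "H \<subseteq> K" and "cyclic_group ((G\<lparr>carrier := K\<rparr>) Mod H)"
proof -
  obtain a where a: "a \<in> carrier G" and K: "K = H <#> {a [^] n | n. n \<in> (UNIV :: int set)}"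
    and HG: "H \<lhd> G" and KG: "K \<lhd> G"
    using assms by (auto simp: cyclic_step_def)
  have Hs: "subgroup H G" and Ks: "subgroup K G" using HG KG by (simp_all add: normal_imp_subgroup)
  have in_K: "h \<otimes> a [^] n \<in> K" if "h \<in> H" for h and n :: int
    using that unfolding K set_mult_def by blast
  show HK: "H \<subseteq> K"
  proof
    fix h assume "h \<in> H"
    then show "h \<in> K" using in_K[of h 0] subgroup.mem_carrier[OF Hs] by simp
  qed
  have aK: "a [^] n \<in> K" for n :: int
    using in_K[OF subgroup.one_closed[OF Hs], of n] a by simp
  have a1: "a \<in> K" using aK[of 1] a by simp
  let ?K = "G\<lparr>carrier := K\<rparr>"
  interpret K: group ?K using Ks by (rule subgroup.subgroup_is_group) (rule is_group)
  have nor: "H \<lhd> ?K"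
    by (rule normal_restrict_supergroup[OF Ks HG HK])
  interpret Q: group "?K Mod H" using nor by (rule normal.factorgroup_is_group)
  have hom: "(\<lambda>x. H #>\<^bsub>?K\<^esub> x) \<in> hom ?K (?K Mod H)"
    by (rule normal.r_coset_hom_Mod[OF nor])
  then interpret hom: group_hom ?K "?K Mod H" "\<lambda>x. H #>\<^bsub>?K\<^esub> x"
    by unfold_locales
  have pow: "(H #>\<^bsub>?K\<^esub> a) [^]\<^bsub>?K Mod H\<^esub> n = H #>\<^bsub>?K\<^esub> (a [^] n)" for n :: int
    using hom.hom_int_pow[of a n] a1 int_pow_consistent[OF Ks a1] by simp
  have "carrier (?K Mod H) = range (\<lambda>n::int. (H #>\<^bsub>?K\<^esub> a) [^]\<^bsub>?K Mod H\<^esub> n)"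
  proof (intro equalityI subsetI)
    fix C assume "C \<in> carrier (?K Mod H)"
    then obtain k where k: "k \<in> K" "C = H #>\<^bsub>?K\<^esub> k" by (auto simp: FactGroup_def RCOSETS_def)
    then obtain h n where hn: "h \<in> H" "k = h \<otimes> a [^] (n :: int)"
      unfolding K set_mult_def by auto
    have "H #> k = H #> (a [^] n)"
      unfolding hn(2)
      using coset_mult_assoc[OF subgroup.subset[OF Hs], of h "a [^] n"] subgroup.mem_carrier[OF Hs hn(1)] a
        coset_join2[OF _ Hs hn(1)] by simp
    then show "C \<in> range (\<lambda>n::int. (H #>\<^bsub>?K\<^esub> a) [^]\<^bsub>?K Mod H\<^esub> n)"
      using k(2) pow by (auto simp: r_coset_def)
  next
    fix C assume "C \<in> range (\<lambda>n::int. (H #>\<^bsub>?K\<^esub> a) [^]\<^bsub>?K Mod H\<^esub> n)"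
    then show "C \<in> carrier (?K Mod H)"
      using Q.int_pow_closed[OF hom.hom_closed[of a]] a1 by auto
  qed
  then show "cyclic_group (?K Mod H)"
    unfolding Q.cyclic_group using hom.hom_closed[of a] a1 by (intro bexI[of _ "H #>\<^bsub>?K\<^esub> a"]) simp_all
qed

lemma (in group) supersolvable_if_cyclic_steps:
  assumes "cyclic_step\<^sup>*\<^sup>* {\<one>} (carrier G)"
  shows "supersolvable G"
proof -
  have "\<exists>(r :: nat) N. N 0 = {\<one>} \<and> N r = K \<and> (\<forall>i\<le>r. N i \<lhd> G) \<and>
      (\<forall>i<r. N i \<subseteq> N (Suc i) \<and> cyclic_group ((G\<lparr>carrier := N (Suc i)\<rparr>) Mod N i))"
    if "cyclic_step\<^sup>*\<^sup>* {\<one>} K" for K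
    using that
  proof induction
    case base
    show ?case by (intro exI[of _ 0] exI[of _ "\<lambda>_. {\<one>}"]) (simp add: one_is_normal)
  next
    case (step H K)
    then obtain r :: nat and N where N: "N 0 = {\<one>}" "N r = H" "\<forall>i\<le>r. N i \<lhd> G"
      "\<forall>i<r. N i \<subseteq> N (Suc i) \<and> cyclic_group ((G\<lparr>carrier := N (Suc i)\<rparr>) Mod N i)" by blast
    show ?case
      using N cyclic_step_quotient[OF step.hyps(2)] step.hyps(2)
      by (intro exI[of _ "Suc r"] exI[of _ "N(Suc r := K)"])
        (auto simp: le_Suc_eq less_Suc_eq cyclic_step_def)
  qed
  from this[OF assms] show ?thesis unfolding supersolvable_def .
qed

text \<open>Adjoin one element of \<open>A\<close> outside \<open>H\<close> at a time:
  \<open>H\<close> is normal, so its product with a cyclic subgroup of \<open>A\<close> is a larger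
  subgroup of \<open>A\<close>, and by hypothesis normal in \<open>G\<close> again.\<close>

lemma (in group) cyclic_steps_if_subgroups_normal:
  assumes fin: "finite A" and A: "subgroup A G"
    and nor: "\<And>H. subgroup H G \<Longrightarrow> H \<subseteq> A \<Longrightarrow> H \<lhd> G"
    and H: "subgroup H G" "H \<subseteq> A"
  shows "cyclic_step\<^sup>*\<^sup>* H A"
  using H
proof (induction "card A - card H" arbitrary: H rule: less_induct)
  case less
  show ?case
  proof (cases "H = A")
    case False
    then obtain a where a: "a \<in> A" "a \<notin> H" using less.prems by blast
    then have aG: "a \<in> carrier G" using subgroup.subset[OF A] by blast
    let ?C = "{a [^] n | n. n \<in> (UNIV :: int set)}"
    let ?K = "H <#> ?C"
    have C: "subgroup ?C G" using generate_is_subgroup[of "{a}"] generate_pow[OF aG] aG by simp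
    have K: "subgroup ?K G"
      by (intro second_isomorphism_grp.normal_set_mult_subgroup second_isomorphism_grp.intro
          second_isomorphism_grp_axioms.intro nor[OF less.prems] C)
    have "a [^] n \<in> A" for n :: int using subgroup_int_pow_closed[OF A a(1)] .
    then have KA: "?K \<subseteq> A"
      using less.prems(2) A unfolding set_mult_def by (auto intro: subgroup.m_closed)
    have step: "cyclic_step H ?K"
      using nor[OF less.prems] nor[OF K KA] aG by (auto simp: cyclic_step_def)
    have "\<one> \<otimes> a [^] (1 :: int) \<in> ?K"
      using subgroup.one_closed[OF less.prems(1)] unfolding set_mult_def by blast
    then have "a \<in> ?K" using aG by simp
    then have "H \<subset> ?K" using cyclic_step_quotient(1)[OF step] a by blast
    moreover have "card ?K \<le> card A" using KA fin by (rule card_mono[rotated])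
    moreover have "finite ?K" using KA fin by (rule finite_subset)
    ultimately have "card A - card ?K < card A - card H"
      using psubset_card_mono[of ?K H] by linarith
    then have "cyclic_step\<^sup>*\<^sup>* ?K A" using less.hyps K KA by blast
    then show ?thesis using step by (rule converse_rtranclp_into_rtranclp[rotated])
  qed simp
qed

lemma (in group) supersolvable_if_comm:
  assumes "finite (carrier G)" and comm: "\<And>x y. x \<in> carrier G \<Longrightarrow> y \<in> carrier G \<Longrightarrow> x \<otimes> y = y \<otimes> x"
  shows "supersolvable G"
proof -
  interpret comm_group G using comm by (intro group.group_comm_groupI is_group)
  show ?thesis
    using assms(1) subgroup_imp_normal triv_subgroup subgroup_self
    by (intro supersolvable_if_cyclic_steps cyclic_steps_if_subgroups_normal) auto
qed

text \<open>If all elements outside \<open>K\<close> are involutions then each of them inverts \<open>K\<close>.\<close>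

lemma (in group) supersolvable_if_involutions:
  assumes fin: "finite (carrier G)" and K: "K \<lhd> G" and x: "x \<in> carrier G" "x \<notin> K"
    and index: "\<And>y z. y \<in> carrier G - K \<Longrightarrow> z \<in> carrier G - K \<Longrightarrow> y \<otimes> z \<in> K"
    and invol: "\<And>y. y \<in> carrier G - K \<Longrightarrow> y \<otimes> y = \<one>"
  shows "supersolvable G"
proof -
  have Ks: "subgroup K G" using K by (rule normal_imp_subgroup)
  have KG: "k \<in> carrier G" if "k \<in> K" for k using that subgroup.subset[OF Ks] by blast
  have out: "y \<otimes> k \<in> carrier G - K" if "y \<in> carrier G - K" "k \<in> K" for y k
  proof -
    have "y \<in> K" if "y \<otimes> k \<in> K"
    proof -
      have "(y \<otimes> k) \<otimes> inv k \<in> K"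
        using subgroup.m_closed[OF Ks that subgroup.m_inv_closed[OF Ks \<open>k \<in> K\<close>]] .
      moreover have "y \<otimes> k \<otimes> inv k = y" using \<open>y \<in> carrier G - K\<close> KG[OF \<open>k \<in> K\<close>] by (simp add: m_assoc)
      ultimately show ?thesis by simp
    qed
    then show ?thesis using that KG by auto
  qed
  have inverts: "y \<otimes> k \<otimes> inv y = inv k" if "y \<in> carrier G - K" "k \<in> K" for y k
  proof -
    have y: "y \<in> carrier G" and k: "k \<in> carrier G" using that KG by auto
    have "inv y = y" using invol[OF that(1)] y by (simp add: inv_equality)
    \<comment> \<open>The product \<open>y \<otimes> k\<close> is again outside \<open>K\<close>, so
      it is an involution too.\<close>
    moreover have "(y \<otimes> k \<otimes> y) \<otimes> k = \<one>"
      using invol[OF out[OF that]] y k by (simp add: m_assoc)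
    then have "inv k = y \<otimes> k \<otimes> y" using y k by (intro inv_equality) auto
    ultimately show ?thesis by simp
  qed
  have normal: "H \<lhd> G" if H: "subgroup H G" "H \<subseteq> K" for H
  proof (rule normal_invI[OF H(1)])
    fix g h assume g: "g \<in> carrier G" and h: "h \<in> H"
    have hK: "h \<in> K" using h H by blast
    show "g \<otimes> h \<otimes> inv g \<in> H"
    proof (cases "g \<in> K")
      case False
      then show ?thesis using inverts[of g h] g hK h H(1) by (simp add: subgroup.m_inv_closed)
    next
      case True
      have xg: "x \<otimes> g \<in> carrier G - K" using out x True by blast
      have xinv: "inv x \<in> carrier G - K"
        using x subgroup.m_inv_closed[OF Ks, of "inv x"] by auto
      \<comment> \<open>An element \<open>g\<close> of \<open>K\<close> is the product of
        \<open>inv x\<close> and \<open>x \<otimes> g\<close>, both outside \<open>K\<close>;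
        conjugation by it inverts \<open>h\<close> twice and hence fixes it.\<close>
      have "g \<otimes> h \<otimes> inv g = inv x \<otimes> ((x \<otimes> g) \<otimes> h \<otimes> inv (x \<otimes> g)) \<otimes> inv (inv x)"
        using x g KG[OF hK] by (simp add: m_assoc inv_mult_group l_inv)
          (simp add: m_assoc[symmetric])
      also have "\<dots> = h"
        using inverts[OF xg hK] inverts[OF xinv, of "inv h"] hK KG[OF hK] Ks
        by (simp add: subgroup.m_inv_closed)
      finally show ?thesis using h by simp
    qed
  qed
  have "cyclic_step\<^sup>*\<^sup>* {\<one>} K"
    using Ks normal triv_subgroup subgroup.one_closed[OF Ks] fin subgroup.subset[OF Ks]
    by (intro cyclic_steps_if_subgroups_normal) (auto intro: finite_subset)
  moreover have "cyclic_step K (carrier G)"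
  proof -
    have "carrier G \<subseteq> K <#> {x [^] n | n. n \<in> (UNIV :: int set)}"
    proof
      fix y assume y: "y \<in> carrier G"
      have "y = y \<otimes> x [^] (0 :: int)" and "y = (y \<otimes> inv x) \<otimes> x [^] (1 :: int)"
        using x y by (simp_all add: m_assoc)
      moreover have "y \<otimes> inv x \<in> K" if "y \<notin> K"
      proof -
        have "inv x = x" using invol[of x] x by (simp add: inv_equality)
        then show ?thesis using index[of y x] that y x by simp
      qed
      ultimately show "y \<in> K <#> {x [^] n | n. n \<in> (UNIV :: int set)}"
        unfolding set_mult_def by blast
    qed
    moreover have "K <#> {x [^] n | n. n \<in> (UNIV :: int set)} \<subseteq> carrier G"
      using x KG unfolding set_mult_def by auto
    ultimately show ?thesis
      using K x normal_self unfolding cyclic_step_def by blast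
  qed
  ultimately show ?thesis
    by (intro supersolvable_if_cyclic_steps) (rule rtranclp.rtrancl_into_rtrancl)
qed

section \<open>Schur's lemma\<close>

locale fin_group = group G for G (structure) +
  assumes fin: "finite (carrier G)"

context group
begin

lemma representation_iff:
  "representation G n \<rho> \<longleftrightarrow> (\<forall>g\<in>carrier G. \<rho> g \<in> carrier_mat n n) \<and>
    (\<forall>g\<in>carrier G. \<forall>h\<in>carrier G. \<rho> (g \<otimes> h) = \<rho> g * \<rho> h) \<and> \<rho> \<one> = 1\<^sub>m n"
  (is "?L \<longleftrightarrow> ?R")
proof
  let ?R' = "ring_mat TYPE(complex) n ()"
  interpret R: ring ?R' by (rule ring_mat)
  {
    assume ?L
    then have hom: "\<rho> \<in> hom G (units_of ?R')" by (simp add: representation_def)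
    then interpret h: group_hom G "units_of ?R'" \<rho>
      using R.units_group by (intro group_hom.intro is_group) (auto simp: group_hom_axioms_def)
    have "\<rho> g \<in> carrier_mat n n" if "g \<in> carrier G" for g
      using h.hom_closed[OF that] by (auto simp: units_of_carrier Units_def ring_mat_simps)
    then show ?R
      using h.hom_mult h.hom_one by (simp add: units_of_mult units_of_one ring_mat_simps)
  next
    assume R: ?R
    have "\<rho> g \<in> Units ?R'" if g: "g \<in> carrier G" for g
    proof -
      have "\<rho> g * \<rho> (inv g) = 1\<^sub>m n" "\<rho> (inv g) * \<rho> g = 1\<^sub>m n"
        using R g by (metis inv_closed r_inv, metis inv_closed l_inv)
      then show ?thesis using R g by (auto simp: Units_def ring_mat_simps)
    qed
    then show ?L
      using R by (auto simp: representation_def hom_def units_of_carrier units_of_mult ring_mat_simps)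
  }
qed

lemma representation_carrier [simp]:
  "representation G n \<rho> \<Longrightarrow> g \<in> carrier G \<Longrightarrow> \<rho> g \<in> carrier_mat n n"
  and representation_mult:
  "representation G n \<rho> \<Longrightarrow> g \<in> carrier G \<Longrightarrow> h \<in> carrier G \<Longrightarrow> \<rho> (g \<otimes> h) = \<rho> g * \<rho> h"
  and representation_one [simp]: "representation G n \<rho> \<Longrightarrow> \<rho> \<one> = 1\<^sub>m n"
  unfolding representation_iff by blast+

lemma representation_pow:
  assumes "representation G n \<rho>" "g \<in> carrier G"
  shows "\<rho> (g [^] k) = \<rho> g ^\<^sub>m k"
proof (induction k)
  case 0
  then show ?case using assms carrier_matD(1)[OF representation_carrier[OF assms]] by simp
next
  case (Suc k)
  then show ?case using assms by (simp add: representation_mult[OF assms(1)])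
qed

lemma character_apply: "g \<in> carrier G \<Longrightarrow> character G \<rho> g = mat_trace (\<rho> g)"
  by (simp add: character_def)

lemma character_one: "representation G n \<rho> \<Longrightarrow> character G \<rho> \<one> = of_nat n"
  by (simp add: character_apply)

lemma character_conj:
  assumes \<rho>: "representation G n \<rho>" and g: "g \<in> carrier G" and h: "h \<in> carrier G"
  shows "character G \<rho> (g \<otimes> h \<otimes> inv g) = character G \<rho> h"
proof -
  have "\<rho> (g \<otimes> h \<otimes> inv g) = \<rho> g * \<rho> h * \<rho> (inv g)" and "\<rho> (inv g) * \<rho> g = 1\<^sub>m n"
    using g h \<rho> by (simp_all add: representation_mult[OF \<rho>, symmetric])
  then show ?thesis
    using g h \<rho> by (simp add: character_apply mat_trace_conj[of _ n])
qed

lemma IrrE: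
  assumes "\<chi> \<in> Irr G"
  obtains n \<rho> where "irreducible_representation G n \<rho>" "representation G n \<rho>" "n > 0" "\<chi> = character G \<rho>"
  using assms unfolding Irr_def irreducible_representation_def by blast

lemma irreducible_representationD:
  assumes "irreducible_representation G n \<rho>"
  shows "representation G n \<rho>" and "n > 0"
    and "\<And>W. invariant_subspace G n \<rho> W \<Longrightarrow> W = {0\<^sub>v n} \<or> W = carrier_vec n"
  using assms unfolding irreducible_representation_def by blast+

text \<open>Kernel and range of \<open>Y\<close> are invariant subspaces. As \<open>Y\<close> is
  nonzero, the kernel is not the whole space and the range is not zero, so irreducibility of
  \<open>\<sigma>\<close> and of \<open>\<rho>\<close> makes \<open>Y\<close> injective and
  surjective.\<close>

lemma intertwiner_invertible:
  assumes \<rho>: "irreducible_representation G n \<rho>" and \<sigma>: "irreducible_representation G m \<sigma>"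
    and Y: "Y \<in> carrier_mat n m" and int: "\<And>g. g \<in> carrier G \<Longrightarrow> \<rho> g * Y = Y * \<sigma> g"
    and nz: "Y \<noteq> 0\<^sub>m n m"
  shows "n = m \<and> (\<exists>X\<in>carrier_mat m n. Y * X = 1\<^sub>m n \<and> X * Y = 1\<^sub>m m)"
proof (rule bijective_mat_inverse[OF Y])
  note \<rho>' = irreducible_representationD[OF \<rho>] and \<sigma>' = irreducible_representationD[OF \<sigma>]
  have int_vec: "\<rho> g *\<^sub>v (Y *\<^sub>v v) = Y *\<^sub>v (\<sigma> g *\<^sub>v v)" if "g \<in> carrier G" "v \<in> carrier_vec m" for g v
    using int[OF that(1)] that Y \<rho>'(1) \<sigma>'(1)
    by (metis assoc_mult_mat_vec representation_carrier)
  have zero: "Y *\<^sub>v 0\<^sub>v m = 0\<^sub>v n" and zero': "A *\<^sub>v 0\<^sub>v n = 0\<^sub>v n" if "A \<in> carrier_mat n n" for A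
    using Y that by (auto intro!: eq_vecI)
  let ?ker = "{v \<in> carrier_vec m. Y *\<^sub>v v = 0\<^sub>v n}"
  have "invariant_subspace G m \<sigma> ?ker"
    unfolding invariant_subspace_def subspace_vec_iff
    using Y zero[of "1\<^sub>m n"] zero' int_vec[symmetric] representation_carrier[OF \<sigma>'(1)]
      representation_carrier[OF \<rho>'(1)]
    by (auto simp: mult_add_distrib_mat_vec mult_mat_vec[of _ n m]
        intro: mult_mat_vec_carrier[OF representation_carrier[OF \<sigma>'(1)]])
  moreover have "?ker \<noteq> carrier_vec m" using mat_eq_0_iff_mult_vec[OF Y] nz by blast
  ultimately have ker: "?ker = {0\<^sub>v m}" using \<sigma>'(3) by blast
  then show "v = 0\<^sub>v m" if "v \<in> carrier_vec m" "Y *\<^sub>v v = 0\<^sub>v n" for v using that by blast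
  let ?im = "(\<lambda>v. Y *\<^sub>v v) ` carrier_vec m"
  have "invariant_subspace G n \<rho> ?im"
    unfolding invariant_subspace_def subspace_vec_iff
  proof (intro conjI ballI allI)
    show "?im \<subseteq> carrier_vec n" using Y by auto
    show "0\<^sub>v n \<in> ?im" using zero[of "1\<^sub>m n"] by (metis image_eqI one_carrier_mat zero_carrier_vec)
    show "v + w \<in> ?im" if "v \<in> ?im" "w \<in> ?im" for v w
      using that Y by (auto simp: mult_add_distrib_mat_vec[symmetric])
    show "c \<cdot>\<^sub>v v \<in> ?im" if "v \<in> ?im" for c v
      using that Y by (auto simp: mult_mat_vec[of _ n m, symmetric])
    show "\<rho> g *\<^sub>v v \<in> ?im" if "g \<in> carrier G" "v \<in> ?im" for g v
      using that int_vec mult_mat_vec_carrier[OF representation_carrier[OF \<sigma>'(1)]] by auto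
  qed
  moreover have "?im \<noteq> {0\<^sub>v n}"
    using mat_eq_0_iff_mult_vec[OF Y] nz by blast
  ultimately have "?im = carrier_vec n" using \<rho>'(3) by blast
  then show "\<exists>v\<in>carrier_vec m. Y *\<^sub>v v = w" if "w \<in> carrier_vec n" for w
    using that by (metis (no_types, lifting) imageE)
qed

lemma intertwiner_character_eq:
  assumes \<rho>: "irreducible_representation G n \<rho>" and \<sigma>: "irreducible_representation G m \<sigma>"
    and Y: "Y \<in> carrier_mat n m" and int: "\<And>g. g \<in> carrier G \<Longrightarrow> \<rho> g * Y = Y * \<sigma> g"
    and nz: "Y \<noteq> 0\<^sub>m n m"
  shows "character G \<rho> = character G \<sigma>"
proof -
  obtain X where X: "X \<in> carrier_mat m n" "Y * X = 1\<^sub>m n" "X * Y = 1\<^sub>m m" and nm: "n = m"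
    using intertwiner_invertible[OF assms] by blast
  note \<rho>' = irreducible_representationD[OF \<rho>] and \<sigma>' = irreducible_representationD[OF \<sigma>]
  have "mat_trace (\<rho> g) = mat_trace (\<sigma> g)" if g: "g \<in> carrier G" for g
  proof -
    have c: "\<rho> g \<in> carrier_mat n n" "\<sigma> g \<in> carrier_mat m m" using \<rho>'(1) \<sigma>'(1) g by auto
    have "\<rho> g = \<rho> g * (Y * X)" using X c by simp
    also have "\<dots> = Y * \<sigma> g * X" using int[OF g] c X Y by (metis assoc_mult_mat)
    also have "mat_trace \<dots> = mat_trace (\<sigma> g)"
      using c X Y nm by (intro mat_trace_conj) auto
    finally show ?thesis .
  qed
  then show ?thesis by (auto simp: character_def)
qed

text \<open>Subtracting an eigenvalue \<open>c\<close> of \<open>Y\<close> gives an intertwiner that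
  kills an eigenvector. It is not invertible, so it vanishes.\<close>

lemma intertwiner_scalar:
  assumes \<rho>: "irreducible_representation G n \<rho>"
    and Y: "Y \<in> carrier_mat n n" and int: "\<And>g. g \<in> carrier G \<Longrightarrow> \<rho> g * Y = Y * \<rho> g"
  shows "\<exists>c. Y = c \<cdot>\<^sub>m 1\<^sub>m n"
proof -
  note \<rho>' = irreducible_representationD[OF \<rho>]
  obtain as where as: "char_poly Y = (\<Prod>a\<leftarrow>as. [:- a, 1:])" "length as = n"
    using char_poly_factorized[OF Y] by blast
  with \<rho>'(2) obtain c where "c \<in> set as" by (cases as) auto
  then have "poly (char_poly Y) c = 0" unfolding as poly_prod_list prod_list_zero_iff by auto
  then have "eigenvalue Y c" using eigenvalue_root_char_poly[OF Y] by blast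
  then obtain v where v: "v \<in> carrier_vec n" "v \<noteq> 0\<^sub>v n" "Y *\<^sub>v v = c \<cdot>\<^sub>v v"
    using Y by (auto simp: eigenvalue_def eigenvector_def)
  define Z where "Z = Y - c \<cdot>\<^sub>m 1\<^sub>m n"
  have Z: "Z \<in> carrier_mat n n" using Y by (auto simp: Z_def intro!: minus_carrier_mat)
  have Zv: "Z *\<^sub>v v = 0\<^sub>v n"
  proof -
    have "(c \<cdot>\<^sub>m 1\<^sub>m n) *\<^sub>v v = c \<cdot>\<^sub>v v"
      using v(1) by (simp add: smult_mat_mult_vec[of _ n n])
    then have "Z *\<^sub>v v = c \<cdot>\<^sub>v v - c \<cdot>\<^sub>v v"
      unfolding Z_def using v Y by (subst minus_mult_distrib_mat_vec[of _ n n]) auto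
    then show ?thesis using v(1) by auto
  qed
  have "Z = 0\<^sub>m n n"
  proof (rule ccontr)
    assume nz: "Z \<noteq> 0\<^sub>m n n"
    have "\<rho> g * Z = Z * \<rho> g" if g: "g \<in> carrier G" for g
    proof -
      have c: "\<rho> g \<in> carrier_mat n n" using \<rho>'(1) g by auto
      have "\<rho> g * Z = \<rho> g * Y - \<rho> g * (c \<cdot>\<^sub>m 1\<^sub>m n)"
        unfolding Z_def using c Y by (intro mult_minus_distrib_mat) auto
      also have "\<rho> g * (c \<cdot>\<^sub>m 1\<^sub>m n) = (c \<cdot>\<^sub>m 1\<^sub>m n) * \<rho> g"
        using c by (metis left_mult_one_mat mult_smult_assoc_mat mult_smult_distrib one_carrier_mat right_mult_one_mat)
      also have "\<rho> g * Y - (c \<cdot>\<^sub>m 1\<^sub>m n) * \<rho> g = Z * \<rho> g"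
        unfolding Z_def int[OF g] using c Y by (intro minus_mult_distrib_mat[symmetric]) auto
      finally show ?thesis .
    qed
    from intertwiner_invertible[OF \<rho> \<rho> Z this nz]
    obtain X where X: "X \<in> carrier_mat n n" "X * Z = 1\<^sub>m n" by blast
    have "v = (X * Z) *\<^sub>v v" using X v by simp
    also have "\<dots> = X *\<^sub>v (Z *\<^sub>v v)" using X Z v by (intro assoc_mult_mat_vec)
    also have "\<dots> = 0\<^sub>v n" unfolding Zv using X by (intro eq_vecI) auto
    finally show False using v by simp
  qed
  then have "Y = c \<cdot>\<^sub>m 1\<^sub>m n"
  proof -
    have "Y $$ (i, j) = (c \<cdot>\<^sub>m 1\<^sub>m n) $$ (i, j)" if "i < n" "j < n" for i j
      using arg_cong[OF \<open>Z = 0\<^sub>m n n\<close>, of "\<lambda>A. A $$ (i, j)"] that Y by (simp add: Z_def)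
    then show ?thesis using Y by (intro eq_matI) auto
  qed
  then show ?thesis ..
qed

end

section \<open>Orthogonality of characters\<close>

context fin_group
begin

lemma card_pos: "card (carrier G) > 0"
  using fin by (auto simp: card_gt_0_iff)

lemma pow_card: "g \<in> carrier G \<Longrightarrow> g [^] card (carrier G) = \<one>"
  using pow_order_eq_1 by (simp add: Coset.order_def)

lemma sum_translate:
  assumes h: "h \<in> carrier G"
  shows "(\<Sum>g\<in>carrier G. f (h \<otimes> g)) = (\<Sum>g\<in>carrier G. f g)"
  by (rule sum.reindex_bij_witness[where i = "\<lambda>g. inv h \<otimes> g" and j = "\<lambda>g. h \<otimes> g"])
    (use h in \<open>auto simp: m_assoc[symmetric]\<close>)

text \<open>Entrywise form of the sum of \<open>\<rho> g * E * \<sigma> (inv g)\<close> over the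
  group, where \<open>E\<close> is the matrix unit with its 1 in row \<open>p\<close> and column
  \<open>q\<close>. The sum is not divided by the group order.\<close>

definition average_intertwiner ::
    "nat \<Rightarrow> nat \<Rightarrow> ('a \<Rightarrow> complex mat) \<Rightarrow> ('a \<Rightarrow> complex mat) \<Rightarrow> nat \<Rightarrow> nat \<Rightarrow> complex mat" where
  "average_intertwiner n m \<rho> \<sigma> p q =
    mat n m (\<lambda>(i, j). \<Sum>g\<in>carrier G. \<rho> g $$ (i, p) * \<sigma> (inv g) $$ (q, j))"

lemma average_intertwiner:
  assumes \<rho>: "representation G n \<rho>" and \<sigma>: "representation G m \<sigma>"
    and p: "p < n" and q: "q < m" and h: "h \<in> carrier G"
  shows "\<rho> h * average_intertwiner n m \<rho> \<sigma> p q = average_intertwiner n m \<rho> \<sigma> p q * \<sigma> h"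
    (is "_ * ?Y = _")
proof (rule eq_matI)
  fix i j assume "i < dim_row (?Y * \<sigma> h)" "j < dim_col (?Y * \<sigma> h)"
  then have i: "i < n" and j: "j < m"
    using carrier_matD[OF representation_carrier[OF \<sigma> h]] by (auto simp: average_intertwiner_def)
  have entry: "(A * B) $$ (i, j) = (\<Sum>k<l. A $$ (i, k) * B $$ (k, j))"
    if "A \<in> carrier_mat a l" "B \<in> carrier_mat l b" "i < a" "j < b" for A B :: "complex mat" and a b l i j
    using that by (auto simp: scalar_prod_def atLeast0LessThan intro!: sum.cong)
  note c = representation_carrier[OF \<rho>] representation_carrier[OF \<sigma>]
  have Y: "?Y \<in> carrier_mat n m" by (simp add: average_intertwiner_def)
  have "(\<rho> h * ?Y) $$ (i, j) = (\<Sum>g\<in>carrier G. (\<Sum>k<n. \<rho> h $$ (i, k) * \<rho> g $$ (k, p)) * \<sigma> (inv g) $$ (q, j))"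
    using entry[OF c(1)[OF h] Y i j] j
    by (simp add: average_intertwiner_def sum_distrib_left sum_distrib_right mult.assoc) (rule sum.swap)
  also have "\<dots> = (\<Sum>g\<in>carrier G. \<rho> (h \<otimes> g) $$ (i, p) * \<sigma> (inv g) $$ (q, j))"
    using h entry[OF c(1) c(1) i p] by (intro sum.cong) (auto simp: representation_mult[OF \<rho>])
  \<comment> \<open>Now the summand depends on \<open>g\<close> only through
    \<open>h \<otimes> g\<close>, and translation by \<open>h\<close> can be undone.\<close>
  also have "\<dots> = (\<Sum>g\<in>carrier G. \<rho> (h \<otimes> g) $$ (i, p) * \<sigma> (inv (h \<otimes> g) \<otimes> h) $$ (q, j))"
    using h by (intro sum.cong) (auto simp: inv_mult_group m_assoc)
  also have "\<dots> = (\<Sum>g\<in>carrier G. \<rho> g $$ (i, p) * \<sigma> (inv g \<otimes> h) $$ (q, j))"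
    using sum_translate[OF h, of "\<lambda>g. \<rho> g $$ (i, p) * \<sigma> (inv g \<otimes> h) $$ (q, j)"] .
  also have "\<dots> = (\<Sum>g\<in>carrier G. \<rho> g $$ (i, p) * (\<Sum>k<m. \<sigma> (inv g) $$ (q, k) * \<sigma> h $$ (k, j)))"
    using h entry[OF c(2) c(2) q j] by (intro sum.cong) (auto simp: representation_mult[OF \<sigma>])
  also have "\<dots> = (?Y * \<sigma> h) $$ (i, j)"
    using entry[OF Y c(2)[OF h] i j] i
    by (simp add: average_intertwiner_def sum_distrib_left sum_distrib_right mult.assoc) (rule sum.swap)
  finally show "(\<rho> h * ?Y) $$ (i, j) = (?Y * \<sigma> h) $$ (i, j)" .
qed (use carrier_matD[OF representation_carrier[OF \<sigma> h]] carrier_matD[OF representation_carrier[OF \<rho> h]]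
  in \<open>auto simp: average_intertwiner_def\<close>)

text \<open>Expanding both traces leaves products of diagonal entries, and each such product, summed
  over the group, is a single entry of the averaged matrix unit.\<close>

lemma sum_characters_entries:
  assumes \<rho>: "representation G n \<rho>" and \<sigma>: "representation G m \<sigma>"
  shows "(\<Sum>g\<in>carrier G. character G \<rho> g * character G \<sigma> (inv g)) =
    (\<Sum>p<n. \<Sum>q<m. average_intertwiner n m \<rho> \<sigma> p q $$ (p, q))"
proof -
  have "(\<Sum>g\<in>carrier G. character G \<rho> g * character G \<sigma> (inv g)) =
      (\<Sum>g\<in>carrier G. \<Sum>p<n. \<Sum>q<m. \<rho> g $$ (p, p) * \<sigma> (inv g) $$ (q, q))"
    using carrier_matD[OF representation_carrier[OF \<sigma>]] carrier_matD[OF representation_carrier[OF \<rho>]]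
    by (intro sum.cong) (auto simp: character_apply mat_trace_def sum_product)
  also have "\<dots> = (\<Sum>p<n. \<Sum>q<m. \<Sum>g\<in>carrier G. \<rho> g $$ (p, p) * \<sigma> (inv g) $$ (q, q))"
    by (subst sum.swap) (intro sum.cong refl sum.swap)
  finally show ?thesis by (simp add: average_intertwiner_def)
qed

lemma character_orthogonality_distinct:
  assumes \<rho>: "irreducible_representation G n \<rho>" and \<sigma>: "irreducible_representation G m \<sigma>"
    and "character G \<rho> \<noteq> character G \<sigma>"
  shows "(\<Sum>g\<in>carrier G. character G \<rho> g * character G \<sigma> (inv g)) = 0"
proof -
  note \<rho>' = irreducible_representationD[OF \<rho>] and \<sigma>' = irreducible_representationD[OF \<sigma>]
  have "average_intertwiner n m \<rho> \<sigma> p q = 0\<^sub>m n m" if "p < n" "q < m" for p q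
    using intertwiner_character_eq[OF \<rho> \<sigma> _ average_intertwiner[OF \<rho>'(1) \<sigma>'(1) that]] assms(3)
    by (auto simp: average_intertwiner_def)
  then show ?thesis by (simp add: sum_characters_entries[OF \<rho>'(1) \<sigma>'(1)])
qed

text \<open>Each average is a scalar matrix whose scalar is found from its trace:
  \<open>card (carrier G)\<close> for \<open>p = q\<close> and 0 otherwise. The \<open>n\<close>
  diagonal pairs contribute \<open>card (carrier G) / n\<close> each.\<close>

lemma character_norm:
  assumes \<rho>: "irreducible_representation G n \<rho>"
  shows "(\<Sum>g\<in>carrier G. character G \<rho> g * character G \<rho> (inv g)) = of_nat (card (carrier G))"
proof -
  note \<rho>' = irreducible_representationD[OF \<rho>]
  let ?Y = "average_intertwiner n n \<rho> \<rho>"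
  have "?Y p q $$ (p, q) = (if p = q then of_nat (card (carrier G)) / of_nat n else 0)" if pq: "p < n" "q < n" for p q
  proof -
    obtain c where c: "?Y p q = c \<cdot>\<^sub>m 1\<^sub>m n"
      using intertwiner_scalar[OF \<rho> _ average_intertwiner[OF \<rho>'(1) \<rho>'(1) pq]]
      by (auto simp: average_intertwiner_def)
    have "c * of_nat n = mat_trace (?Y p q)"
      unfolding c by (simp add: mat_trace_smult[of _ n])
    also have "\<dots> = (\<Sum>i<n. \<Sum>g\<in>carrier G. \<rho> g $$ (i, p) * \<rho> (inv g) $$ (q, i))"
      by (auto simp: mat_trace_def average_intertwiner_def)
    also have "\<dots> = (\<Sum>g\<in>carrier G. \<Sum>i<n. \<rho> (inv g) $$ (q, i) * \<rho> g $$ (i, p))"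
      by (subst sum.swap) (simp add: mult.commute)
    also have "\<dots> = (\<Sum>g\<in>carrier G. (\<rho> (inv g) * \<rho> g) $$ (q, p))"
      using pq carrier_matD[OF representation_carrier[OF \<rho>'(1)]]
      by (intro sum.cong) (auto simp: scalar_prod_def atLeast0LessThan)
    also have "\<dots> = (\<Sum>g\<in>carrier G. (1\<^sub>m n :: complex mat) $$ (q, p))"
      using \<rho>'(1) by (intro sum.cong) (auto simp: representation_mult[symmetric])
    also have "\<dots> = (if p = q then of_nat (card (carrier G)) else 0)"
      using pq by simp
    finally have "c = (if p = q then of_nat (card (carrier G)) else 0) / of_nat n"
      using \<rho>'(2) by (simp add: field_simps)
    then show ?thesis using pq unfolding c by simp
  qed
  then have "(\<Sum>g\<in>carrier G. character G \<rho> g * character G \<rho> (inv g)) =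
      (\<Sum>p<n. \<Sum>q<n. if p = q then of_nat (card (carrier G)) / of_nat n else 0)"
    by (simp add: sum_characters_entries[OF \<rho>'(1) \<rho>'(1)])
  also have "\<dots> = of_nat (card (carrier G))" using \<rho>'(2) by simp
  finally show ?thesis .
qed

lemma character_pow:
  assumes \<rho>: "representation G n \<rho>" and g: "g \<in> carrier G"
  shows "\<exists>f. (\<forall>i<n. f i ^ card (carrier G) = 1) \<and> (\<forall>k. character G \<rho> (g [^] k) = (\<Sum>i<n. f i ^ k))"
proof -
  have "\<rho> g ^\<^sub>m card (carrier G) = 1\<^sub>m n"
    using representation_pow[OF \<rho> g, of "card (carrier G)"] pow_card[OF g] \<rho> by simp
  with finite_order_mat_trace_pow[OF representation_carrier[OF \<rho> g]] show ?thesis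
    using representation_pow[OF \<rho> g] g by (simp add: character_apply)
qed

text \<open>The inverse of \<open>g\<close> is its power with exponent
  \<open>card (carrier G) - 1\<close>, and for a root of unity of that order this power is the
  complex conjugate.\<close>

lemma character_inv:
  assumes \<rho>: "representation G n \<rho>" and g: "g \<in> carrier G"
  shows "character G \<rho> (inv g) = cnj (character G \<rho> g)"
proof -
  obtain f where f: "\<And>i. i < n \<Longrightarrow> f i ^ card (carrier G) = 1"
    and ch: "\<And>k. character G \<rho> (g [^] k) = (\<Sum>i<n. f i ^ k)"
    using character_pow[OF assms] by blast
  have N: "card (carrier G) = Suc (card (carrier G) - 1)" using card_pos by simp
  have "g [^] (card (carrier G) - 1) \<otimes> g = \<one>"
    using pow_card[OF g] by (metis N nat_pow_Suc)
  then have "inv g = g [^] (card (carrier G) - 1)" using g by (intro inv_equality) auto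
  then have "character G \<rho> (inv g) = (\<Sum>i<n. f i ^ (card (carrier G) - 1))" by (simp add: ch)
  also have "\<dots> = (\<Sum>i<n. cnj (f i))"
  proof (rule sum.cong[OF refl])
    fix i assume "i \<in> {..<n}"
    then have one: "f i ^ card (carrier G) = 1" using f by simp
    then have "norm (f i) ^ card (carrier G) = 1" by (metis norm_one norm_power)
    then have "norm (f i) = 1" using power_eq_imp_eq_base[of "norm (f i)" "card (carrier G)" 1] card_pos by simp
    then have c: "f i * cnj (f i) = 1" by (simp add: complex_norm_square[symmetric])
    have "f i ^ (card (carrier G) - 1) * f i = 1" using one N by (metis power_Suc2)
    then show "f i ^ (card (carrier G) - 1) = cnj (f i)"
      using c by (metis mult.assoc mult.commute mult_1)
  qed
  also have "\<dots> = cnj (character G \<rho> g)" using ch[of 1] g by simp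
  finally show ?thesis .
qed

section \<open>Orthonormality, Bessel's inequality and finiteness of \<open>Irr G\<close>\<close>

lemma Irr_orthonormal:
  assumes \<chi>: "\<chi> \<in> Irr G" and \<psi>: "\<psi> \<in> Irr G"
  shows "(\<Sum>g\<in>carrier G. \<chi> g * cnj (\<psi> g)) = (if \<chi> = \<psi> then of_nat (card (carrier G)) else 0)"
proof -
  obtain n \<rho> where \<rho>: "irreducible_representation G n \<rho>" "\<chi> = character G \<rho>" using IrrE[OF \<chi>] by metis
  obtain m \<sigma> where \<sigma>: "irreducible_representation G m \<sigma>" "\<psi> = character G \<sigma>" using IrrE[OF \<psi>] by metis
  have "(\<Sum>g\<in>carrier G. \<chi> g * cnj (\<psi> g)) = (\<Sum>g\<in>carrier G. \<chi> g * \<psi> (inv g))"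
    unfolding \<sigma>(2) using character_inv[OF irreducible_representationD(1)[OF \<sigma>(1)]]
    by (intro sum.cong) auto
  also have "\<dots> = (if \<chi> = \<psi> then of_nat (card (carrier G)) else 0)"
    using character_orthogonality_distinct[OF \<rho>(1) \<sigma>(1)] character_norm[OF \<rho>(1)] \<rho>(2) \<sigma>(2) by auto
  finally show ?thesis .
qed

text \<open>The function \<open>h\<close> is the orthogonal projection of \<open>f\<close> onto the
  span of \<open>F\<close>, and the inequality says that \<open>f - h\<close> has nonnegative
  squared length. The factor \<open>card (carrier G)\<close> is there because the inner product is
  not normalized.\<close>

lemma Irr_bessel:
  fixes f :: "'a \<Rightarrow> complex"
  assumes F: "finite F" "F \<subseteq> Irr G"
  shows "(\<Sum>\<chi>\<in>F. (norm (\<Sum>g\<in>carrier G. f g * cnj (\<chi> g)))\<^sup>2) \<le> card (carrier G) * (\<Sum>g\<in>carrier G. (norm (f g))\<^sup>2)"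
proof -
  define N :: complex where "N = of_nat (card (carrier G))"
  have N: "N \<noteq> 0" "cnj N = N" using card_pos by (simp_all add: N_def)
  define a where "a \<chi> = (\<Sum>g\<in>carrier G. f g * cnj (\<chi> g))" for \<chi>
  define h where "h g = (\<Sum>\<chi>\<in>F. a \<chi> / N * \<chi> g)" for g
  define A where "A = (\<Sum>\<chi>\<in>F. a \<chi> * cnj (a \<chi>))"
  have fh: "(\<Sum>g\<in>carrier G. f g * cnj (h g)) = A / N"
  proof -
    have "(\<Sum>g\<in>carrier G. f g * cnj (h g)) = (\<Sum>g\<in>carrier G. \<Sum>\<chi>\<in>F. cnj (a \<chi>) / N * (f g * cnj (\<chi> g)))"
      using N by (simp add: h_def sum_distrib_left mult_ac)
    also have "\<dots> = (\<Sum>\<chi>\<in>F. cnj (a \<chi>) / N * a \<chi>)"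
      by (subst sum.swap) (simp add: a_def sum_distrib_left)
    finally show ?thesis by (simp add: A_def sum_divide_distrib mult_ac)
  qed
  have "(\<Sum>g\<in>carrier G. h g * cnj (f g)) = cnj (\<Sum>g\<in>carrier G. f g * cnj (h g))"
    by (simp add: mult.commute)
  also have "\<dots> = A / N" unfolding fh using N by (simp add: A_def mult.commute)
  finally have hf: "(\<Sum>g\<in>carrier G. h g * cnj (f g)) = A / N" .
  have hh: "(\<Sum>g\<in>carrier G. h g * cnj (h g)) = A / N"
  proof -
    have "(\<Sum>g\<in>carrier G. h g * cnj (h g)) =
        (\<Sum>g\<in>carrier G. \<Sum>\<chi>\<in>F. \<Sum>\<psi>\<in>F. a \<chi> / N * (cnj (a \<psi>) / N) * (\<chi> g * cnj (\<psi> g)))"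
      using N by (simp add: h_def sum_product mult_ac)
    also have "\<dots> = (\<Sum>\<chi>\<in>F. \<Sum>\<psi>\<in>F. \<Sum>g\<in>carrier G. a \<chi> / N * (cnj (a \<psi>) / N) * (\<chi> g * cnj (\<psi> g)))"
      by (subst sum.swap) (intro sum.cong refl sum.swap)
    also have "\<dots> = (\<Sum>\<chi>\<in>F. \<Sum>\<psi>\<in>F. a \<chi> / N * (cnj (a \<psi>) / N) * (if \<chi> = \<psi> then N else 0))"
      using F Irr_orthonormal unfolding sum_distrib_left[symmetric] N_def
      by (intro sum.cong refl) (auto simp: subset_iff)
    also have "\<dots> = (\<Sum>\<chi>\<in>F. a \<chi> * cnj (a \<chi>) / N)"
      using F(1) N by (simp add: if_distrib[where f = "\<lambda>x. _ * x"] cong: if_cong)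
    finally show ?thesis by (simp add: A_def sum_divide_distrib)
  qed
  have "complex_of_real (\<Sum>g\<in>carrier G. (norm (f g - h g))\<^sup>2) = (\<Sum>g\<in>carrier G. (f g - h g) * cnj (f g - h g))"
    by (simp add: complex_norm_square del: complex_cnj_diff of_real_power)
  also have "\<dots> = (\<Sum>g\<in>carrier G. f g * cnj (f g)) - A / N"
    using fh hf hh by (simp add: algebra_simps sum.distrib sum_subtractf)
  also have "\<dots> = complex_of_real ((\<Sum>g\<in>carrier G. (norm (f g))\<^sup>2) - (\<Sum>\<chi>\<in>F. (norm (a \<chi>))\<^sup>2) / card (carrier G))"
    by (simp add: A_def N_def complex_norm_square del: of_real_power)
  finally have "(\<Sum>g\<in>carrier G. (norm (f g - h g))\<^sup>2) =
      (\<Sum>g\<in>carrier G. (norm (f g))\<^sup>2) - (\<Sum>\<chi>\<in>F. (norm (a \<chi>))\<^sup>2) / card (carrier G)"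
    unfolding of_real_eq_iff .
  moreover have "(\<Sum>g\<in>carrier G. (norm (f g - h g))\<^sup>2) \<ge> 0" by (intro sum_nonneg) auto
  ultimately have "(\<Sum>\<chi>\<in>F. (norm (a \<chi>))\<^sup>2) / card (carrier G) \<le> (\<Sum>g\<in>carrier G. (norm (f g))\<^sup>2)"
    by linarith
  then show ?thesis using card_pos by (simp add: a_def divide_le_eq mult.commute)
qed

lemma Irr_one_ge_1:
  assumes "\<chi> \<in> Irr G"
  shows "\<exists>n>0. \<chi> \<one> = of_nat n"
  using IrrE[OF assms] character_one by metis

text \<open>Bessel's inequality for the indicator of \<open>\<one>\<close>: every character
  contributes its squared degree, at least 1, and the right-hand side is
  \<open>card (carrier G)\<close>.\<close>

lemma finite_Irr: "finite (Irr G)"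
proof (rule ccontr)
  assume "infinite (Irr G)"
  then obtain F where F: "finite F" "F \<subseteq> Irr G" "card F = Suc (card (carrier G))"
    using infinite_arbitrarily_large by blast
  have "real (card F) \<le> (\<Sum>\<chi>\<in>F. (norm (\<Sum>g\<in>carrier G. (if g = \<one> then 1 else 0) * cnj (\<chi> g)))\<^sup>2)"
  proof -
    have "1 \<le> (norm (\<Sum>g\<in>carrier G. (if g = \<one> then 1 else 0) * cnj (\<chi> g)))\<^sup>2" if "\<chi> \<in> F" for \<chi>
    proof -
      have "(\<Sum>g\<in>carrier G. (if g = \<one> then 1 else 0) * cnj (\<chi> g)) = cnj (\<chi> \<one>)"
        using fin by (simp add: if_distrib[where f = "\<lambda>x. x * _"] cong: if_cong)
      moreover obtain n :: nat where "n > 0" "\<chi> \<one> = of_nat n"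
        using Irr_one_ge_1 \<open>\<chi> \<in> F\<close> F(2) by blast
      ultimately show ?thesis by (simp add: power_le_one_iff one_le_power)
    qed
    from sum_mono[OF this] show ?thesis by simp
  qed
  also have "\<dots> \<le> card (carrier G) * (\<Sum>g\<in>carrier G. (norm (if g = \<one> then 1 else 0 :: complex))\<^sup>2)"
    by (rule Irr_bessel[OF F(1,2)])
  also have "(\<Sum>g\<in>carrier G. (norm (if g = \<one> then 1 else 0 :: complex))\<^sup>2) = 1"
    using fin by (simp add: if_distrib[where f = "\<lambda>x. (norm x)\<^sup>2"] cong: if_cong)
  finally show False using F(3) by simp
qed

section \<open>Linear characters and Burnside's theorem on zeros\<close>

lemma Irr_extensional: "\<chi> \<in> Irr G \<Longrightarrow> \<chi> \<in> extensional (carrier G)"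
  by (auto simp: Irr_def character_def)

lemma Irr_class_function:
  assumes "\<chi> \<in> Irr G" "g \<in> carrier G" "h \<in> carrier G"
  shows "\<chi> (g \<otimes> h \<otimes> inv g) = \<chi> h"
  using IrrE[OF assms(1)] character_conj[OF _ assms(2,3)] by metis

definition Lin :: "('a \<Rightarrow> complex) set" where
  "Lin = {\<mu> \<in> Irr G. \<mu> \<one> = 1}"

definition twist :: "('a \<Rightarrow> complex) \<Rightarrow> ('a \<Rightarrow> complex) \<Rightarrow> 'a \<Rightarrow> complex" where
  "twist \<mu> \<chi> = (\<lambda>g\<in>carrier G. \<mu> g * \<chi> g)"

lemma Lin_Irr: "\<mu> \<in> Lin \<Longrightarrow> \<mu> \<in> Irr G" and Lin_one: "\<mu> \<in> Lin \<Longrightarrow> \<mu> \<one> = 1"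
  by (auto simp: Lin_def)

lemma finite_Lin: "finite Lin"
  using finite_Irr by (auto simp: Lin_def)

text \<open>The value at \<open>\<one>\<close> is the dimension, so the matrices are 1 by 1 and the
  trace is their only entry.\<close>

lemma Lin_mult:
  assumes \<mu>: "\<mu> \<in> Lin" and g: "g \<in> carrier G" and h: "h \<in> carrier G"
  shows "\<mu> (g \<otimes> h) = \<mu> g * \<mu> h"
proof -
  obtain n \<rho> where \<rho>: "representation G n \<rho>" and eq: "\<mu> = character G \<rho>" using IrrE[OF Lin_Irr[OF \<mu>]] by metis
  then have n: "n = 1" using character_one[OF \<rho>] Lin_one[OF \<mu>] by simp
  have "mat_trace A = A $$ (0, 0)" if "A \<in> carrier_mat 1 1" for A using that by (simp add: mat_trace_def)
  moreover have "A * B \<in> carrier_mat 1 1" "(A * B) $$ (0, 0) = A $$ (0, 0) * B $$ (0, 0)"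
    if "A \<in> carrier_mat 1 1" "B \<in> carrier_mat 1 1" for A B :: "complex mat"
    using that by (auto simp: scalar_prod_def)
  ultimately show ?thesis
    using representation_carrier[OF \<rho>, unfolded n] g h
    unfolding eq by (simp only: character_apply representation_mult[OF \<rho>] m_closed)
qed

lemma Lin_inv:
  assumes \<mu>: "\<mu> \<in> Lin" and g: "g \<in> carrier G"
  shows "\<mu> g * cnj (\<mu> g) = 1"
proof -
  have "\<mu> (inv g) = cnj (\<mu> g)" using IrrE[OF Lin_Irr[OF \<mu>]] character_inv[OF _ g] by metis
  then show ?thesis using Lin_mult[OF \<mu> g, of "inv g"] g Lin_one[OF \<mu>] by simp
qed

lemma LinI:
  assumes ext: "\<mu> \<in> extensional (carrier G)" and one: "\<mu> \<one> = 1"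
    and mult: "\<And>g h. g \<in> carrier G \<Longrightarrow> h \<in> carrier G \<Longrightarrow> \<mu> (g \<otimes> h) = \<mu> g * \<mu> h"
  shows "\<mu> \<in> Lin"
proof -
  define \<rho> where "\<rho> g = mat 1 1 (\<lambda>_. \<mu> g)" for g
  have "\<mu> = character G \<rho>"
    using ext by (intro extensionalityI[OF ext]) (auto simp: character_def \<rho>_def mat_trace_def)
  moreover have "representation G 1 \<rho>"
    unfolding representation_iff using mult one
    by (auto simp: \<rho>_def scalar_prod_def intro!: eq_matI)
  moreover have "W = {0\<^sub>v 1} \<or> W = carrier_vec 1" if inv: "invariant_subspace G 1 \<rho> W" for W
  proof (cases "W \<subseteq> {0\<^sub>v 1}")
    case True
    then show ?thesis using inv by (auto simp: invariant_subspace_def subspace_vec_iff)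
  next
    case False
    note W = inv[unfolded invariant_subspace_def subspace_vec_iff]
    from False obtain w where w: "w \<in> W" "w \<noteq> 0\<^sub>v 1" by blast
    then have w1: "w \<in> carrier_vec 1" using W by blast
    have w0: "w $ 0 \<noteq> 0"
    proof
      assume "w $ 0 = 0"
      then have "w = 0\<^sub>v 1" using w1 by (intro eq_vecI) auto
      with w show False by blast
    qed
    have "v \<in> W" if v: "v \<in> carrier_vec 1" for v
    proof -
      have "v = (v $ 0 / w $ 0) \<cdot>\<^sub>v w" using v w1 w0 by (intro eq_vecI) auto
      then show ?thesis using W w by metis
    qed
    then show ?thesis using W by blast
  qed
  ultimately show ?thesis
    using one unfolding Lin_def Irr_def irreducible_representation_def by auto
qed

text \<open>Scaling each \<open>\<rho> g\<close> by the nonzero number \<open>\<mu> g\<close> does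
  not change which subspaces are invariant.\<close>

lemma twist_Irr:
  assumes \<mu>: "\<mu> \<in> Lin" and \<chi>: "\<chi> \<in> Irr G"
  shows "twist \<mu> \<chi> \<in> Irr G"
proof -
  obtain n \<rho> where irr: "irreducible_representation G n \<rho>" and \<rho>: "representation G n \<rho>" and n: "n > 0"
    and eq: "\<chi> = character G \<rho>" using IrrE[OF \<chi>] by metis
  define \<sigma> where "\<sigma> g = \<mu> g \<cdot>\<^sub>m \<rho> g" for g
  note c = representation_carrier[OF \<rho>]
  have \<sigma>: "representation G n \<sigma>"
    unfolding representation_iff
  proof (intro conjI ballI)
    show "\<sigma> g \<in> carrier_mat n n" if "g \<in> carrier G" for g using c that by (simp add: \<sigma>_def)
    show "\<sigma> \<one> = 1\<^sub>m n" using \<rho> Lin_one[OF \<mu>] by (auto simp: \<sigma>_def)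
    show "\<sigma> (g \<otimes> h) = \<sigma> g * \<sigma> h" if g: "g \<in> carrier G" and h: "h \<in> carrier G" for g h
    proof -
      have "\<sigma> g * \<sigma> h = \<mu> g \<cdot>\<^sub>m (\<rho> g * \<sigma> h)"
        using c[OF g] c[OF h] by (simp add: \<sigma>_def mult_smult_assoc_mat[of _ n n _ n])
      also have "\<dots> = \<mu> g \<cdot>\<^sub>m (\<mu> h \<cdot>\<^sub>m (\<rho> g * \<rho> h))"
        using c[OF g] c[OF h] by (simp add: \<sigma>_def mult_smult_distrib[of _ n n _ n])
      also have "\<dots> = \<sigma> (g \<otimes> h)"
        using g h by (auto simp: \<sigma>_def Lin_mult[OF \<mu>] representation_mult[OF \<rho>] intro!: eq_matI)
      finally show ?thesis ..
    qed
  qed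
  have "W = {0\<^sub>v n} \<or> W = carrier_vec n" if inv: "invariant_subspace G n \<sigma> W" for W
  proof -
    note W = inv[unfolded invariant_subspace_def subspace_vec_iff]
    have "\<rho> g *\<^sub>v w \<in> W" if g: "g \<in> carrier G" and w: "w \<in> W" for g w
    proof -
      have wc: "w \<in> carrier_vec n" using W w by blast
      have "cnj (\<mu> g) \<cdot>\<^sub>v (\<sigma> g *\<^sub>v w) = (\<mu> g * cnj (\<mu> g)) \<cdot>\<^sub>v (\<rho> g *\<^sub>v w)"
        unfolding \<sigma>_def using wc c[OF g]
        by (subst smult_mat_mult_vec[of _ n n]) (auto intro!: eq_vecI)
      also have "\<dots> = \<rho> g *\<^sub>v w" unfolding Lin_inv[OF \<mu> g] by simp
      finally show ?thesis using W w g by metis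
    qed
    then have "invariant_subspace G n \<rho> W"
      using inv unfolding invariant_subspace_def by blast
    then show ?thesis using irreducible_representationD(3)[OF irr] by blast
  qed
  then have "irreducible_representation G n \<sigma>"
    using \<sigma> n unfolding irreducible_representation_def by blast
  moreover have "twist \<mu> \<chi> = character G \<sigma>"
    unfolding eq twist_def character_def using c
    by (intro restrict_ext) (simp add: \<sigma>_def mat_trace_smult[of _ n])
  ultimately show ?thesis unfolding Irr_def by blast
qed

text \<open>The eigenvalues of \<open>g\<close> are powers of one root of unity, and
  \<open>p\<close> is the sum of the corresponding monomials. Since \<open>p\<close> does not depend
  on \<open>k\<close>, raising the root of unity to a power amounts to raising \<open>g\<close> to
  that power.\<close>

lemma character_int_poly:
  assumes \<chi>: "\<chi> \<in> Irr G" and g: "g \<in> carrier G"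
  shows "\<exists>p :: int poly. \<forall>k. \<chi> (g [^] (k :: nat)) = poly (of_int_poly p) (root_cis (card (carrier G)) ^ k)"
proof -
  obtain n \<rho> where \<rho>: "representation G n \<rho>" and eq: "\<chi> = character G \<rho>" using IrrE[OF \<chi>] by metis
  obtain f where f: "\<forall>i<n. f i ^ card (carrier G) = 1"
    and ch: "\<forall>k. character G \<rho> (g [^] k) = (\<Sum>i<n. f i ^ k)"
    using character_pow[OF \<rho> g] by blast
  have "\<forall>i\<in>{..<n}. \<exists>e. f i = root_cis (card (carrier G)) ^ e"
    using f root_of_unity_cis[OF card_pos] by simp
  then obtain e where e: "\<And>i. i < n \<Longrightarrow> f i = root_cis (card (carrier G)) ^ e i"
    unfolding bchoice_iff by auto
  have "\<chi> (g [^] k) = poly (of_int_poly (\<Sum>i<n. Polynomial.monom 1 (e i))) (root_cis (card (carrier G)) ^ k)" for k :: nat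
  proof -
    have "of_int_poly (\<Sum>i<n. Polynomial.monom 1 (e i)) = (\<Sum>i<n. Polynomial.monom (1 :: complex) (e i))"
      by (simp add: of_int_poly_hom.hom_sum)
    then show ?thesis
      using e ch by (simp add: eq poly_sum poly_monom power_mult[symmetric] mult.commute)
  qed
  then show ?thesis by blast
qed

text \<open>The inverse map is the power with exponent \<open>x\<close>, an inverse of
  \<open>j\<close> modulo the group order.\<close>

lemma coprime_pow_bij:
  assumes j: "coprime j (card (carrier G))"
  shows "bij_betw (\<lambda>g. g [^] j) (carrier G - {\<one>}) (carrier G - {\<one>})"
proof -
  obtain x where x: "[j * x = 1] (mod card (carrier G))"
    using cong_solve_coprime_nat[OF j] by auto
  have mod: "g [^] (k mod card (carrier G)) = g [^] k" if g: "g \<in> carrier G" for g and k :: nat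
  proof -
    have "g [^] k = g [^] (card (carrier G) * (k div card (carrier G)) + k mod card (carrier G))" by simp
    also have "\<dots> = g [^] (k mod card (carrier G))"
      using g by (simp only: nat_pow_mult[symmetric] nat_pow_pow[symmetric] pow_card nat_pow_one) simp
    finally show ?thesis ..
  qed
  have inverse: "g [^] (j * x) = g" if "g \<in> carrier G" for g
    using x mod[OF that, of "j * x"] mod[OF that, of 1] that by (simp add: cong_def)
  have cancel: "(g [^] j) [^] x = g" "(g [^] x) [^] j = g" if "g \<in> carrier G" for g
    using inverse[OF that] that by (simp_all add: nat_pow_pow mult.commute)
  then have "g [^] j \<noteq> \<one>" "g [^] x \<noteq> \<one>" if "g \<in> carrier G - {\<one>}" for g
    using that by (metis DiffE insertCI nat_pow_one)+
  with cancel show ?thesis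
    by (intro bij_betw_byWitness[where f' = "\<lambda>g. g [^] x"]) auto
qed

text \<open>Raising to a power prime to \<open>\<bar>G\<bar>\<close> permutes \<open>G - {1}\<close>, so the product of the values of \<open>\<chi>\<close> on this set
  is Galois invariant, hence an integer. If it is nonzero, the arithmetic-geometric mean inequality
  contradicts the norm relation.\<close>

theorem nonlinear_character_has_zero:
  assumes \<chi>: "\<chi> \<in> Irr G" and nonlin: "\<chi> \<one> \<noteq> 1"
  shows "\<exists>g\<in>carrier G. \<chi> g = 0"
proof (rule ccontr)
  assume "\<not> ?thesis"
  then have nz: "\<chi> g \<noteq> 0" if "g \<in> carrier G" for g using that by blast
  let ?S = "carrier G - {\<one>}" and ?z = "root_cis (card (carrier G))"
  have "\<forall>g\<in>carrier G. \<exists>p :: int poly. \<forall>k. \<chi> (g [^] (k :: nat)) = poly (of_int_poly p) (?z ^ k)"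
    using character_int_poly[OF \<chi>] by blast
  then obtain p :: "'a \<Rightarrow> int poly"
    where p: "\<And>g k. g \<in> carrier G \<Longrightarrow> \<chi> (g [^] (k :: nat)) = poly (of_int_poly (p g)) (?z ^ k)"
    unfolding bchoice_iff by blast
  \<comment> \<open>A single integer polynomial whose value at \<open>?z ^ k\<close> is the product
    of all \<open>\<chi> (g [^] k)\<close>; for \<open>k\<close> prime to the group order the
    factors are merely permuted.\<close>
  define q where "q = prod p ?S"
  have q: "poly (of_int_poly q) (?z ^ k) = (\<Prod>g\<in>?S. \<chi> (g [^] k))" for k
    using p by (simp add: q_def of_int_poly_hom.hom_prod poly_prod)
  have q1: "poly (of_int_poly q) ?z = prod \<chi> ?S" using q[of 1] by simp
  have "poly (of_int_poly q) (?z ^ j) = poly (of_int_poly q) ?z" if "coprime j (card (carrier G))" for j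
    unfolding q q1 using prod.reindex_bij_betw[OF coprime_pow_bij[OF that]] .
  then have "prod \<chi> ?S \<in> \<int>"
    using galois_invariant_Ints[OF card_pos] unfolding q1[symmetric] by blast
  then obtain c :: int where c: "prod \<chi> ?S = of_int c" by (auto elim: Ints_cases)
  moreover have "prod \<chi> ?S \<noteq> 0" using nz fin by simp
  ultimately have "c \<noteq> 0" by auto
  then have "1 \<le> norm (prod \<chi> ?S)" unfolding c by simp
  then have "1 \<le> (norm (prod \<chi> ?S))\<^sup>2" by (simp add: one_le_power)
  then have "1 \<le> (\<Prod>g\<in>?S. (norm (\<chi> g))\<^sup>2)" by (simp add: prod_norm[symmetric] prod_power_distrib)
  then have "real (card ?S) \<le> (\<Sum>g\<in>?S. (norm (\<chi> g))\<^sup>2)"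
    using nz fin by (intro card_le_sum_if_prod_ge_1) auto
  moreover have "complex_of_real (\<Sum>g\<in>carrier G. (norm (\<chi> g))\<^sup>2) = complex_of_real (card (carrier G))"
    using Irr_orthonormal[OF \<chi> \<chi>] by (simp add: complex_norm_square del: of_real_power)
  then have "(\<Sum>g\<in>carrier G. (norm (\<chi> g))\<^sup>2) = card (carrier G)" unfolding of_real_eq_iff .
  \<comment> \<open>The squared norms have mean 1 over the group. The identity takes more than its
    share, so the mean over \<open>?S\<close> would fall below 1, against the bound just
    obtained.\<close>
  then have "(norm (\<chi> \<one>))\<^sup>2 + (\<Sum>g\<in>?S. (norm (\<chi> g))\<^sup>2) = card (carrier G)"
    using fin by (subst (asm) sum.remove[of _ "\<one>"]) auto
  moreover have "real (card (carrier G)) = 1 + real (card ?S)"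
    using card_Suc_Diff1[OF fin one_closed] by linarith
  moreover have "(norm (\<chi> \<one>))\<^sup>2 > 1"
  proof -
    obtain n :: nat where n: "n > 0" "\<chi> \<one> = of_nat n" using Irr_one_ge_1[OF \<chi>] by blast
    with nonlin have "n > 1" by (cases "n = 1") auto
    then show ?thesis using n by (simp add: one_less_power)
  qed
  ultimately show False by linarith
qed

section \<open>Counting zeros\<close>

definition conj_class :: "'a \<Rightarrow> 'a set" where
  "conj_class x = (\<lambda>g. g \<otimes> x \<otimes> inv g) ` carrier G"

lemma conjugacy_classes_eq: "conjugacy_classes G = conj_class ` carrier G"
  by (auto simp: conjugacy_classes_def orbits_def orbit_def conj_class_def image_def)

lemma conj_class_self: "x \<in> carrier G \<Longrightarrow> x \<in> conj_class x"
  unfolding conj_class_def by (rule image_eqI[of _ _ "\<one>"]) auto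

lemma conj_class_carrier: "x \<in> carrier G \<Longrightarrow> conj_class x \<subseteq> carrier G"
  by (auto simp: conj_class_def)

lemma finite_conjugacy_classes: "finite (conjugacy_classes G)"
  using fin by (simp add: conjugacy_classes_eq)

lemma Irr_conj_class:
  assumes "\<chi> \<in> Irr G" "x \<in> carrier G" "y \<in> conj_class x"
  shows "\<chi> y = \<chi> x"
  using assms Irr_class_function by (auto simp: conj_class_def)

definition zero_classes :: "('a \<Rightarrow> complex) \<Rightarrow> 'a set set" where
  "zero_classes \<chi> = {C \<in> conjugacy_classes G. \<forall>g\<in>C. \<chi> g = 0}"

lemma finite_zero_classes: "finite (zero_classes \<chi>)"
  using finite_conjugacy_classes by (simp add: zero_classes_def)

lemma nz_eq: "nz G = (\<Sum>\<chi>\<in>Irr G. card (zero_classes \<chi>))"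
proof -
  have "{(\<chi>, C). \<chi> \<in> Irr G \<and> C \<in> conjugacy_classes G \<and> (\<forall>g\<in>C. \<chi> g = 0)} = Sigma (Irr G) zero_classes"
    by (auto simp: zero_classes_def)
  then show ?thesis using finite_Irr finite_zero_classes by (simp add: nz_def)
qed

lemma zero_in_zero_classes:
  assumes "\<chi> \<in> Irr G" "g \<in> carrier G" "\<chi> g = 0"
  shows "conj_class g \<in> zero_classes \<chi>"
  using assms Irr_conj_class[OF assms(1,2)] by (auto simp: zero_classes_def conjugacy_classes_eq)

lemma zero_classes_nonempty:
  assumes "\<chi> \<in> Irr G - Lin"
  shows "card (zero_classes \<chi>) \<ge> 1"
proof -
  obtain g where "g \<in> carrier G" "\<chi> g = 0"
    using nonlinear_character_has_zero[of \<chi>] assms by (auto simp: Lin_def)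
  then have "zero_classes \<chi> \<noteq> {}" using zero_in_zero_classes assms by blast
  then show ?thesis using finite_zero_classes[of \<chi>] by (simp add: Suc_le_eq card_gt_0_iff)
qed

section \<open>Common kernels of linear characters and the size of conjugacy classes\<close>

definition common_kernel :: "('a \<Rightarrow> complex) set \<Rightarrow> 'a set" where
  "common_kernel S = {g \<in> carrier G. \<forall>\<mu>\<in>S. \<mu> g = 1}"

lemma Lin_inverse: "\<mu> \<in> Lin \<Longrightarrow> g \<in> carrier G \<Longrightarrow> \<mu> (inv g) = cnj (\<mu> g)"
  using IrrE[OF Lin_Irr] character_inv by metis

lemma common_kernel_normal:
  assumes "S \<subseteq> Lin"
  shows "common_kernel S \<lhd> G"
proof (rule normal_invI)
  have SL: "\<mu> \<in> Lin" if "\<mu> \<in> S" for \<mu> using that assms by blast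
  show "subgroup (common_kernel S) G"
    by unfold_locales (auto simp: common_kernel_def SL Lin_mult Lin_one Lin_inverse)
  show "g \<otimes> h \<otimes> inv g \<in> common_kernel S" if "g \<in> carrier G" "h \<in> common_kernel S" for g h
    using that by (auto simp: common_kernel_def SL Lin_Irr Irr_class_function)
qed

lemma finite_common_kernel: "finite (common_kernel S)"
  using fin by (simp add: common_kernel_def)

lemma common_kernel_card_pos: "S \<subseteq> Lin \<Longrightarrow> card (common_kernel S) > 0"
  using finite_common_kernel subgroup.one_closed[OF normal_imp_subgroup[OF common_kernel_normal]]
  by (auto simp: card_gt_0_iff)

text \<open>This is Bessel's inequality for the indicator function of the kernel.\<close>

lemma card_mult_common_kernel_le:
  assumes S: "S \<subseteq> Lin"
  shows "card S * card (common_kernel S) \<le> card (carrier G)"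
proof -
  let ?K = "common_kernel S"
  let ?f = "\<lambda>g. if g \<in> ?K then 1 else 0 :: complex"
  have K: "?K \<subseteq> carrier G" by (auto simp: common_kernel_def)
  have "(\<Sum>g\<in>carrier G. ?f g * cnj (\<mu> g)) = card ?K" if "\<mu> \<in> S" for \<mu>
  proof -
    have "(\<Sum>g\<in>carrier G. ?f g * cnj (\<mu> g)) = (\<Sum>g\<in>carrier G. ?f g)"
      using that by (intro sum.cong) (auto simp: common_kernel_def)
    also have "\<dots> = card ?K" using fin K by (simp add: sum.If_cases Int_absorb1)
    finally show ?thesis .
  qed
  \<comment> \<open>All members of \<open>S\<close> have the same inner product with the indicator,
    so Bessel's inequality is the claim multiplied by \<open>card ?K\<close>.\<close>
  then have "(\<Sum>\<mu>\<in>S. (norm (\<Sum>g\<in>carrier G. ?f g * cnj (\<mu> g)))\<^sup>2) = card S * (card ?K)\<^sup>2"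
    by simp
  moreover have "(\<Sum>g\<in>carrier G. (norm (?f g))\<^sup>2) = card ?K"
  proof -
    have "(\<Sum>g\<in>carrier G. (norm (?f g))\<^sup>2) = (\<Sum>g\<in>carrier G. if g \<in> ?K then 1 else 0)"
      by (intro sum.cong) auto
    also have "\<dots> = card ?K" using fin K by (simp add: sum.If_cases Int_absorb1)
    finally show ?thesis .
  qed
  ultimately have "real (card S * (card ?K)\<^sup>2) \<le> real (card (carrier G) * card ?K)"
    using Irr_bessel[of S ?f] S Lin_Irr finite_subset[OF S finite_Lin] by auto
  then have "card S * (card ?K)\<^sup>2 \<le> card (carrier G) * card ?K" unfolding of_nat_le_iff .
  then show ?thesis using common_kernel_card_pos[OF S] by (simp add: power2_eq_square)
qed

lemma card_conjugacy_class_le: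
  assumes "C \<in> conjugacy_classes G"
  shows "card C \<le> card (common_kernel Lin)"
proof -
  obtain x where x: "x \<in> carrier G" "C = conj_class x" using assms by (auto simp: conjugacy_classes_eq)
  have "C \<subseteq> (\<lambda>d. d \<otimes> x) ` common_kernel Lin"
  proof
    fix y assume "y \<in> C"
    then have y: "y \<in> carrier G" "y \<in> conj_class x" using x conj_class_carrier by auto
    have "\<mu> (y \<otimes> inv x) = 1" if "\<mu> \<in> Lin" for \<mu>
      using that x(1) y Irr_conj_class[OF Lin_Irr[OF that] x(1) y(2)]
      by (simp add: Lin_mult Lin_inverse Lin_inv)
    then have "y \<otimes> inv x \<in> common_kernel Lin" using x y by (auto simp: common_kernel_def)
    moreover have "y = (y \<otimes> inv x) \<otimes> x" using x y by (simp add: m_assoc)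
    ultimately show "y \<in> (\<lambda>d. d \<otimes> x) ` common_kernel Lin" by blast
  qed
  then have "card C \<le> card ((\<lambda>d. d \<otimes> x) ` common_kernel Lin)"
    using finite_common_kernel by (intro card_mono) auto
  also have "\<dots> \<le> card (common_kernel Lin)" using finite_common_kernel by (rule card_image_le)
  finally show ?thesis .
qed

section \<open>The action of linear characters by multiplication\<close>

definition twist_stabilizer :: "('a \<Rightarrow> complex) \<Rightarrow> ('a \<Rightarrow> complex) set" where
  "twist_stabilizer \<chi> = {\<mu> \<in> Lin. twist \<mu> \<chi> = \<chi>}"

definition twist_orbit :: "('a \<Rightarrow> complex) \<Rightarrow> ('a \<Rightarrow> complex) set" where
  "twist_orbit \<chi> = (\<lambda>\<mu>. twist \<mu> \<chi>) ` Lin"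

lemma twist_stabilizer_Lin: "twist_stabilizer \<chi> \<subseteq> Lin"
  by (auto simp: twist_stabilizer_def)

lemma Lin_nonzero: "\<mu> \<in> Lin \<Longrightarrow> g \<in> carrier G \<Longrightarrow> \<mu> g \<noteq> 0"
  using Lin_inv[of \<mu> g] by auto

lemma trivial_Lin: "(\<lambda>g\<in>carrier G. 1) \<in> Lin"
  by (rule LinI) auto

lemma twist_Lin: "\<mu> \<in> Lin \<Longrightarrow> \<nu> \<in> Lin \<Longrightarrow> twist \<mu> \<nu> \<in> Lin"
  using twist_Irr[of \<mu> \<nu>] Lin_Irr[of \<nu>] Lin_one[of \<mu>] Lin_one[of \<nu>] one_closed
  unfolding mem_Collect_eq Lin_def by (simp add: twist_def)

text \<open>Some \<open>\<mu>\<close> in the stabilizer has \<open>\<mu> g \<noteq> 1\<close>, while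
  \<open>\<mu> g * \<chi> g = \<chi> g\<close>.\<close>

lemma zero_outside_stabilizer_kernel:
  assumes "g \<in> carrier G - common_kernel (twist_stabilizer \<chi>)"
  shows "\<chi> g = 0"
proof -
  obtain \<mu> where \<mu>: "\<mu> \<in> twist_stabilizer \<chi>" "\<mu> g \<noteq> 1" and g: "g \<in> carrier G"
    using assms by (auto simp: common_kernel_def)
  then have "twist \<mu> \<chi> g = \<chi> g" by (simp add: twist_stabilizer_def)
  then have "\<mu> g * \<chi> g = \<chi> g" using g by (simp add: twist_def)
  then show ?thesis using \<mu>(2) by simp
qed

lemma outside_stabilizer_kernel_subset:
  assumes "\<chi> \<in> Irr G"
  shows "carrier G - common_kernel (twist_stabilizer \<chi>) \<subseteq> \<Union> (zero_classes \<chi>)"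
  using zero_in_zero_classes[OF assms] zero_outside_stabilizer_kernel conj_class_self by blast

text \<open>The zero classes cover everything outside the kernel of the stabilizer, and none of them
  is larger than the common kernel of \<open>Lin\<close>.\<close>

lemma card_zero_classes_ge:
  assumes \<chi>: "\<chi> \<in> Irr G"
  shows "card (carrier G) - card (common_kernel (twist_stabilizer \<chi>))
    \<le> card (zero_classes \<chi>) * card (common_kernel Lin)"
proof -
  let ?K = "common_kernel (twist_stabilizer \<chi>)"
  have "card (carrier G) - card ?K = card (carrier G - ?K)"
    using finite_common_kernel by (intro card_Diff_subset[symmetric]) (auto simp: common_kernel_def)
  also have "\<dots> \<le> card (\<Union> (zero_classes \<chi>))"
    using outside_stabilizer_kernel_subset[OF \<chi>] finite_zero_classes fin conj_class_carrier
    by (intro card_mono finite_Union)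
      (auto simp: zero_classes_def conjugacy_classes_eq intro: finite_subset[OF conj_class_carrier fin])
  also have "\<dots> \<le> (\<Sum>C\<in>zero_classes \<chi>. card C)"
    by (rule card_Union_le_sum_card)
  also have "\<dots> \<le> card (zero_classes \<chi>) * card (common_kernel Lin)"
    using card_conjugacy_class_le by (intro sum_bounded_above[THEN order_trans]) (auto simp: zero_classes_def)
  finally show ?thesis .
qed

text \<open>With \<open>a = m / s\<close> the orbit length, this is \<open>z \<ge> m - a\<close>
  cleared of its denominator. It combines \<open>N - k \<le> z * d\<close> with the two Bessel
  bounds \<open>m * d \<le> N\<close> and \<open>s * k \<le> N\<close>; real numbers avoid truncated
  subtraction.\<close>

lemma card_zero_classes_ge_index:
  assumes \<chi>: "\<chi> \<in> Irr G"
  shows "card Lin * (card (twist_stabilizer \<chi>) - 1) \<le> card (twist_stabilizer \<chi>) * card (zero_classes \<chi>)"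
proof -
  define N where "N = real (card (carrier G))"
  define d where "d = real (card (common_kernel Lin))"
  define k where "k = real (card (common_kernel (twist_stabilizer \<chi>)))"
  define m where "m = real (card Lin)"
  define s where "s = real (card (twist_stabilizer \<chi>))"
  define z where "z = real (card (zero_classes \<chi>))"
  have N: "N > 0" using card_pos by (simp add: N_def)
  have md: "m * d \<le> N"
    using card_mult_common_kernel_le[of Lin] unfolding m_def d_def N_def of_nat_mult[symmetric] of_nat_le_iff by simp
  have sk: "s * k \<le> N"
    using card_mult_common_kernel_le[OF twist_stabilizer_Lin]
    unfolding s_def k_def N_def of_nat_mult[symmetric] of_nat_le_iff by simp
  have zd: "N - k \<le> z * d"
    using card_zero_classes_ge[OF \<chi>] unfolding z_def d_def N_def k_def of_nat_mult[symmetric] by linarith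
  have nonneg: "s \<ge> 0" "m \<ge> 0" "z \<ge> 0" by (simp_all add: s_def m_def z_def)
  have "m * (s - 1) * N = m * (s * N - N)" by (simp add: algebra_simps)
  also have "\<dots> \<le> m * (s * N - s * k)" using sk nonneg by (intro mult_left_mono) auto
  also have "\<dots> = m * s * (N - k)" by (simp add: algebra_simps)
  also have "\<dots> \<le> m * s * (z * d)" using zd nonneg by (intro mult_left_mono) auto
  also have "\<dots> = s * z * (m * d)" by simp
  also have "\<dots> \<le> s * z * N" using md nonneg by (intro mult_left_mono) auto
  finally have *: "m * (s - 1) \<le> s * z" using N by simp
  have "real (card Lin * (card (twist_stabilizer \<chi>) - 1)) \<le> real (card (twist_stabilizer \<chi>) * card (zero_classes \<chi>))"
  proof (cases "card (twist_stabilizer \<chi>) = 0")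
    case False
    then show ?thesis using * by (simp add: m_def s_def z_def of_nat_diff)
  qed simp
  then show ?thesis unfolding of_nat_le_iff .
qed

text \<open>Orbit-stabilizer counting: the linear characters that send \<open>\<chi>\<close> to a
  given member of its orbit form a translate of the stabilizer. The conjugate character
  \<open>\<mu>'\<close> undoes the translation by \<open>\<mu>\<close>.\<close>

lemma card_twist_orbit:
  assumes \<chi>: "\<chi> \<in> Irr G"
  shows "card Lin = card (twist_orbit \<chi>) * card (twist_stabilizer \<chi>)"
proof -
  have "card {\<nu> \<in> Lin. twist \<nu> \<chi> = \<psi>} = card (twist_stabilizer \<chi>)" if "\<psi> \<in> twist_orbit \<chi>" for \<psi>
  proof -
    obtain \<mu> where \<mu>: "\<mu> \<in> Lin" "\<psi> = twist \<mu> \<chi>" using \<open>\<psi> \<in> twist_orbit \<chi>\<close> by (auto simp: twist_orbit_def)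
    define \<mu>' where "\<mu>' = (\<lambda>g\<in>carrier G. cnj (\<mu> g))"
    have \<mu>': "\<mu>' \<in> Lin"
      using Lin_mult[OF \<mu>(1)] Lin_one[OF \<mu>(1)] by (intro LinI) (auto simp: \<mu>'_def)
    have cancel: "twist \<mu>' (twist \<mu> \<nu>) = \<nu>" "twist \<mu> (twist \<mu>' \<nu>) = \<nu>" if "\<nu> \<in> Irr G" for \<nu>
      using Irr_extensional[OF that] Lin_inv[OF \<mu>(1)]
      by (auto simp: twist_def \<mu>'_def fun_eq_iff extensional_def mult.assoc[symmetric] mult.commute[of "cnj _"])
    have assoc: "twist (twist \<alpha> \<beta>) \<chi> = twist \<alpha> (twist \<beta> \<chi>)" for \<alpha> \<beta>
      by (auto simp: twist_def fun_eq_iff)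
    have "bij_betw (twist \<mu>) (twist_stabilizer \<chi>) {\<nu> \<in> Lin. twist \<nu> \<chi> = \<psi>}"
      by (rule bij_betw_byWitness[where f' = "twist \<mu>'"])
        (use cancel \<mu> \<mu>' twist_Lin \<chi> in \<open>auto simp: twist_stabilizer_def assoc Lin_Irr\<close>)
    from bij_betw_same_card[OF this] show ?thesis by simp
  qed
  then have "(\<Sum>\<psi>\<in>twist_orbit \<chi>. \<Sum>\<nu> | \<nu> \<in> Lin \<and> twist \<nu> \<chi> = \<psi>. 1) = card (twist_orbit \<chi>) * card (twist_stabilizer \<chi>)"
    by simp
  moreover have "(\<Sum>\<psi>\<in>twist_orbit \<chi>. \<Sum>\<nu> | \<nu> \<in> Lin \<and> twist \<nu> \<chi> = \<psi>. 1) = (\<Sum>\<nu>\<in>Lin. 1 :: nat)"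
    using finite_Lin by (intro sum.group) (auto simp: twist_orbit_def)
  ultimately show ?thesis by simp
qed

lemma twist_orbit_subset:
  assumes \<chi>: "\<chi> \<in> Irr G - Lin"
  shows "twist_orbit \<chi> \<subseteq> Irr G - Lin"
proof
  fix \<psi> assume "\<psi> \<in> twist_orbit \<chi>"
  then obtain \<mu> where \<mu>: "\<mu> \<in> Lin" "\<psi> = twist \<mu> \<chi>" by (auto simp: twist_orbit_def)
  then have "\<psi> \<one> = \<chi> \<one>" using Lin_one by (simp add: twist_def)
  moreover have "\<chi> \<one> \<noteq> 1" using \<chi> by (simp add: Lin_def)
  ultimately show "\<psi> \<in> Irr G - Lin" using twist_Irr[OF \<mu>(1)] \<chi> \<mu>(2) Lin_one by force
qed

text \<open>Linear characters have no zeros, so multiplying by one neither creates nor removes a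
  zero.\<close>

lemma zero_classes_twist_orbit:
  assumes "\<psi> \<in> twist_orbit \<chi>"
  shows "zero_classes \<psi> = zero_classes \<chi>"
proof -
  have "\<psi> g = 0 \<longleftrightarrow> \<chi> g = 0" if "g \<in> carrier G" for g
    using assms Lin_nonzero that by (auto simp: twist_orbit_def twist_def)
  then show ?thesis
    using conj_class_carrier by (fastforce simp: zero_classes_def conjugacy_classes_eq)
qed

section \<open>Lower bounds for the number of zeros and their consequences\<close>

lemma nz_ge_nonlinear: "card (Irr G - Lin) \<le> nz G"
proof -
  have "card (Irr G - Lin) \<le> (\<Sum>\<chi>\<in>Irr G - Lin. card (zero_classes \<chi>))"
    using zero_classes_nonempty sum_mono[of "Irr G - Lin" "\<lambda>_. 1" "\<lambda>\<chi>. card (zero_classes \<chi>)"] by simp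
  also have "\<dots> \<le> nz G" unfolding nz_eq using finite_Irr by (intro sum_mono2) auto
  finally show ?thesis .
qed

lemma nz_ge_orbit:
  assumes "\<chi> \<in> Irr G - Lin"
  shows "card (twist_orbit \<chi>) * card (zero_classes \<chi>) \<le> nz G"
proof -
  have "card (twist_orbit \<chi>) * card (zero_classes \<chi>) = (\<Sum>\<psi>\<in>twist_orbit \<chi>. card (zero_classes \<psi>))"
    using zero_classes_twist_orbit by simp
  also have "\<dots> \<le> nz G" unfolding nz_eq
    using finite_Irr twist_orbit_subset[OF assms] by (intro sum_mono2) auto
  finally show ?thesis .
qed

lemma card_Irr: "card (Irr G) = card Lin + card (Irr G - Lin)"
proof -
  have "Lin \<subseteq> Irr G" using Lin_Irr by blast
  then show ?thesis using card_Diff_subset[OF finite_Lin] card_mono[OF finite_Irr] by fastforce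
qed

text \<open>Counting zeros along a twist orbit and summing over all nonlinear characters leaves only the
  case of a single nonlinear character and two linear ones.\<close>

lemma few_zeros_nonlinear:
  assumes few: "2 * nz G < card (Irr G)" and \<chi>: "\<chi> \<in> Irr G - Lin"
  shows "card Lin = 2" and "twist_stabilizer \<chi> = Lin" and "card (zero_classes \<chi>) = 1"
proof -
  define m where "m = card Lin"
  define t where "t = card (Irr G - Lin)"
  have few': "2 * nz G < m + t" using few card_Irr by (simp add: m_def t_def)
  have tm: "t < m" using nz_ge_nonlinear few' by (simp add: t_def)
  have orbit1: "card (twist_orbit \<psi>) = 1" if \<psi>: "\<psi> \<in> Irr G - Lin" for \<psi>
  proof -
    define a where "a = card (twist_orbit \<psi>)"
    define s where "s = card (twist_stabilizer \<psi>)"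
    define z where "z = card (zero_classes \<psi>)"
    have m: "m = a * s" using card_twist_orbit \<psi> by (simp add: m_def a_def s_def)
    have "a \<le> t" using twist_orbit_subset[OF \<psi>] finite_Irr by (auto simp: a_def t_def intro: card_mono)
    \<comment> \<open>From \<open>m = a * s\<close> and \<open>a \<le> t < m\<close> the stabilizer
      cannot be trivial; this makes \<open>m * (s - 1)\<close> at least half of
      \<open>m * s\<close>.\<close>
    then have "s \<ge> 2" using tm m by (cases s; cases "s - 1") auto
    have "m * (s - 1) \<le> s * z"
      using card_zero_classes_ge_index \<psi> by (simp add: m_def s_def z_def)
    moreover have "m * s \<le> 2 * (m * (s - 1))" using \<open>s \<ge> 2\<close> by (cases s) (auto simp: algebra_simps)
    ultimately have "m * s \<le> 2 * (s * z)" by linarith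
    then have "m * s \<le> (2 * z) * s" by (simp add: mult_ac)
    then have "m \<le> 2 * z" using \<open>s \<ge> 2\<close> by simp
    \<comment> \<open>All \<open>a\<close> members of the orbit have the same \<open>z\<close> zero
      classes, and together they must stay below \<open>m\<close>.\<close>
    then have "a * m \<le> 2 * (a * z)" by (metis mult.left_commute mult_le_mono2)
    also have "\<dots> \<le> 2 * nz G" using nz_ge_orbit[OF \<psi>] by (simp add: a_def z_def)
    also have "\<dots> < 2 * m" using few' tm by simp
    finally have "a < 2" using tm by simp
    moreover have "a \<noteq> 0" using m tm by (intro notI) simp
    ultimately show ?thesis by (simp add: a_def)
  qed
  have stab: "twist_stabilizer \<psi> = Lin" if \<psi>: "\<psi> \<in> Irr G - Lin" for \<psi>
    using card_twist_orbit[of \<psi>] orbit1[OF \<psi>] \<psi> twist_stabilizer_Lin finite_Lin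
    by (intro card_subset_eq) auto
  then show "twist_stabilizer \<chi> = Lin" using \<chi> .
  have z: "m - 1 \<le> card (zero_classes \<psi>)" if \<psi>: "\<psi> \<in> Irr G - Lin" for \<psi>
    using card_zero_classes_ge_index[of \<psi>] stab[OF \<psi>] \<psi> tm by (simp add: m_def)
  have "t * (m - 1) \<le> (\<Sum>\<psi>\<in>Irr G - Lin. card (zero_classes \<psi>))"
    using z sum_mono[of "Irr G - Lin" "\<lambda>_. m - 1" "\<lambda>\<psi>. card (zero_classes \<psi>)"] by (simp add: t_def)
  also have "\<dots> \<le> nz G" unfolding nz_eq using finite_Irr by (intro sum_mono2) auto
  finally have tz: "t * (m - 1) \<le> nz G" .
  have t: "t \<ge> 1" using \<chi> finite_Irr by (auto simp: t_def Suc_le_eq card_gt_0_iff)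
  then have "m - 1 \<le> t * (m - 1)" by simp
  then have "2 * (m - 1) < m + t" using tz few' by linarith
  have "m = 2"
  proof (rule ccontr)
    assume "m \<noteq> 2"
    then have "m \<ge> 3" using t tm by linarith
    \<comment> \<open>For \<open>m \<ge> 3\<close> the product \<open>t * (m - 1)\<close> is at
      least \<open>(t - 1) + (m - 1)\<close>, which would give \<open>m + t < 4\<close>. The values
      \<open>m = 3\<close>, \<open>t = 1\<close> miss this by exactly one.\<close>
    have "2 * (t * (m - 1)) < m + t" using tz few' by linarith
    moreover have "(t - 1) * (m - 1) + (m - 1) = t * (m - 1)" using t by (cases t) auto
    moreover have "t - 1 \<le> (t - 1) * (m - 1)" using mult_le_mono2[of 1 "m - 1" "t - 1"] \<open>m \<ge> 3\<close> by fastforce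
    ultimately show False using \<open>m \<ge> 3\<close> t by linarith
  qed
  then show "card Lin = 2" by (simp add: m_def)
  have "card (zero_classes \<chi>) \<le> nz G"
    using nz_ge_orbit[OF \<chi>] orbit1[OF \<chi>] by simp
  \<comment> \<open>Now \<open>t < m = 2\<close> gives \<open>t = 1\<close>, so
    \<open>2 * nz G < 3\<close>.\<close>
  then have "card (zero_classes \<chi>) \<le> 1" using few' tm \<open>m = 2\<close> t by linarith
  then show "card (zero_classes \<chi>) = 1" using zero_classes_nonempty[OF \<chi>] by linarith
qed

text \<open>Two bounds meet: the complement of \<open>?K\<close> has at least half of the elements
  of \<open>G\<close> and lies in the zero class \<open>C\<close>, which has at most
  \<open>card ?K\<close> elements, hence at most half. So \<open>C\<close> is the complement, and
  its elements have centralizers of order 2.\<close>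

lemma single_zero_class_supersolvable:
  assumes \<chi>: "\<chi> \<in> Irr G - Lin"
    and m: "card Lin = 2" and stab: "twist_stabilizer \<chi> = Lin" and z: "card (zero_classes \<chi>) = 1"
  shows "supersolvable G"
proof -
  let ?K = "common_kernel Lin"
  have K: "?K \<lhd> G" by (rule common_kernel_normal) simp
  have KG: "?K \<subseteq> carrier G" by (auto simp: common_kernel_def)
  have le: "2 * card ?K \<le> card (carrier G)"
    using card_mult_common_kernel_le[of Lin] m by simp
  obtain C where C: "zero_classes \<chi> = {C}" using z by (auto simp: card_1_singleton_iff)
  have CC: "C \<in> conjugacy_classes G" using C by (auto simp: zero_classes_def)
  have "carrier G - ?K \<subseteq> C" using outside_stabilizer_kernel_subset[of \<chi>] \<chi> C stab by auto
  moreover have finC: "finite C" using CC fin conj_class_carrier by (auto simp: conjugacy_classes_eq intro: finite_subset)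
  moreover have diff: "card (carrier G - ?K) = card (carrier G) - card ?K"
    using finite_common_kernel KG by (rule card_Diff_subset)
  ultimately have C_eq: "carrier G - ?K = C" and CK: "2 * card C = card (carrier G)"
  proof -
    assume sub: "carrier G - ?K \<subseteq> C"
    have "card C \<le> card (carrier G - ?K)"
      using card_conjugacy_class_le[OF CC] diff le by linarith
    then show "carrier G - ?K = C" using sub finC by (intro card_seteq)
    then have "card C = card (carrier G) - card ?K" using diff by simp
    then show "2 * card C = card (carrier G)"
      using card_conjugacy_class_le[OF CC] le card_pos by linarith
  qed
  have "C \<noteq> {}" using CK card_pos by auto
  then obtain x where x: "x \<in> carrier G" "x \<notin> ?K" using C_eq by blast
  interpret conj: group_action G "carrier G" "\<lambda>g. \<lambda>h \<in> carrier G. g \<otimes> h \<otimes> inv g"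
    by (rule action_by_conjugation)
  have invol: "y \<otimes> y = \<one>" if y: "y \<in> carrier G - ?K" for y
  proof -
    let ?st = "stabilizer G (\<lambda>g. \<lambda>h \<in> carrier G. g \<otimes> h \<otimes> inv g) y"
    have yG: "y \<in> carrier G" using y by blast
    have orb: "orbit G (\<lambda>g. \<lambda>h \<in> carrier G. g \<otimes> h \<otimes> inv g) u = conj_class u" if "u \<in> carrier G" for u
      using that by (auto simp: orbit_def conj_class_def)
    have "C = conj_class y"
      using zero_in_zero_classes[of \<chi> y] zero_outside_stabilizer_kernel[of y \<chi>] y stab C \<chi> by auto
    then have "card C * card ?st = card (carrier G)"
      using conj.orbit_stabilizer_theorem[OF yG] orb[OF yG] by (simp add: Coset.order_def)
    then have "card C * card ?st = card C * 2" using CK by simp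
    then have st2: "card ?st = 2" using card_pos CK by simp
    \<comment> \<open>The stabilizer under conjugation is the centralizer of \<open>y\<close>. It
      has two elements, so \<open>y \<otimes> y\<close> has to coincide with
      \<open>\<one>\<close>.\<close>
    have "{\<one>, y, y \<otimes> y} \<subseteq> ?st" using yG by (auto simp: stabilizer_def m_assoc)
    moreover have "finite ?st" using st2 by (intro card_ge_0_finite) simp
    ultimately have "card {\<one>, y, y \<otimes> y} \<le> 2" using card_mono[of ?st "{\<one>, y, y \<otimes> y}"] st2 by linarith
    moreover have "y \<noteq> \<one>" using y subgroup.one_closed[OF normal_imp_subgroup[OF K]] by auto
    moreover have "y \<otimes> y \<noteq> y" using yG \<open>y \<noteq> \<one>\<close> by simp
    ultimately show ?thesis by (auto simp: card_insert_if split: if_splits)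
  qed
  have index: "y \<otimes> w \<in> ?K" if y: "y \<in> carrier G - ?K" and w: "w \<in> carrier G - ?K" for y w
  proof -
    obtain u where u: "u \<in> carrier G" "C = conj_class u" using CC by (auto simp: conjugacy_classes_eq)
    have "\<mu> (y \<otimes> w) = 1" if \<mu>: "\<mu> \<in> Lin" for \<mu>
    proof -
      \<comment> \<open>Since \<open>y\<close> and \<open>w\<close> are conjugate, no linear
        character distinguishes \<open>y \<otimes> w\<close> from
        \<open>y \<otimes> y = \<one>\<close>.\<close>
      have "\<mu> y = \<mu> u" "\<mu> w = \<mu> u"
        using Irr_conj_class[OF Lin_Irr[OF \<mu>] u(1)] y w C_eq u(2) by blast+
      then have "\<mu> (y \<otimes> w) = \<mu> (y \<otimes> y)" using Lin_mult[OF \<mu>] y w by simp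
      then show ?thesis using invol[OF y] Lin_one[OF \<mu>] by simp
    qed
    then show ?thesis using y w by (auto simp: common_kernel_def)
  qed
  show ?thesis using supersolvable_if_involutions[OF fin K x index invol] .
qed

section \<open>Groups all of whose irreducible characters are linear\<close>

text \<open>The left regular representation by permutation matrices, with \<open>f\<close> numbering
  the group elements. It is faithful because a translation with a fixed point is the
  identity.\<close>

lemma exists_faithful_representation:
  "\<exists>n \<rho>. representation G n \<rho> \<and> (\<forall>g\<in>carrier G. \<rho> g = 1\<^sub>m n \<longrightarrow> g = \<one>)"
proof -
  define n where "n = card (carrier G)"
  obtain f where f: "bij_betw f {..<n} (carrier G)"
    using ex_bij_betw_nat_finite[OF fin] by (auto simp: n_def atLeast0LessThan)
  have fG: "f i \<in> carrier G" if "i < n" for i using f that by (auto simp: bij_betw_def)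
  have f_eq: "f i = f j \<longleftrightarrow> i = j" if "i < n" "j < n" for i j
    using f that by (auto simp: bij_betw_def inj_on_def)
  define \<rho> where "\<rho> g = mat n n (\<lambda>(i, j). if f i = g \<otimes> f j then 1 else 0 :: complex)" for g
  have "representation G n \<rho>"
    unfolding representation_iff
  proof (intro conjI ballI)
    show "\<rho> g \<in> carrier_mat n n" for g by (simp add: \<rho>_def)
    show "\<rho> \<one> = 1\<^sub>m n" using f_eq fG by (intro eq_matI) (auto simp: \<rho>_def)
    fix g h assume g: "g \<in> carrier G" and h: "h \<in> carrier G"
    show "\<rho> (g \<otimes> h) = \<rho> g * \<rho> h"
    proof (rule eq_matI)
      fix i j assume "i < dim_row (\<rho> g * \<rho> h)" "j < dim_col (\<rho> g * \<rho> h)"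
      then have ij: "i < n" "j < n" by (simp_all add: \<rho>_def)
      have "h \<otimes> f j \<in> carrier G" using h fG[OF ij(2)] by simp
      then obtain l where l: "l < n" "f l = h \<otimes> f j"
        using f by (metis bij_betw_imp_surj_on imageE lessThan_iff)
      have "(\<rho> g * \<rho> h) $$ (i, j) = (\<Sum>k<n. (if f i = g \<otimes> f k then 1 else 0) * (if f k = f l then 1 else 0))"
        using ij l(2) by (auto simp: \<rho>_def scalar_prod_def atLeast0LessThan intro!: sum.cong)
      also have "\<dots> = (\<Sum>k<n. if k = l then if f i = g \<otimes> f l then 1 else 0 else 0)"
        using f_eq[OF _ l(1)] by (intro sum.cong) auto
      also have "\<dots> = \<rho> (g \<otimes> h) $$ (i, j)"
        using l ij g h fG[OF ij(2)] by (simp add: \<rho>_def m_assoc)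
      finally show "\<rho> (g \<otimes> h) $$ (i, j) = (\<rho> g * \<rho> h) $$ (i, j)" ..
    qed (simp_all add: \<rho>_def)
  qed
  moreover have "g = \<one>" if g: "g \<in> carrier G" "\<rho> g = 1\<^sub>m n" for g
  proof -
    have n: "0 < n" using card_pos by (simp add: n_def)
    have "\<rho> g $$ (0, 0) = 1" using g n by simp
    then have "f 0 = g \<otimes> f 0" using n by (simp add: \<rho>_def split: if_splits)
    then show ?thesis using fG[OF n] g(1) by simp
  qed
  ultimately show ?thesis by blast
qed

text \<open>The columns of an injective \<open>P\<close> are a basis of \<open>W\<close>, and
  \<open>\<sigma> g\<close> is the matrix of \<open>\<rho> g\<close> in it, given by
  \<open>\<rho> g * P = P * \<sigma> g\<close>. Left cancellation of \<open>P\<close> makes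
  \<open>\<sigma>\<close> multiplicative. The last clause carries triviality of
  \<open>\<sigma> g\<close> back to \<open>W\<close>.\<close>

lemma subrepresentation:
  assumes \<rho>: "representation G n \<rho>" and inv: "invariant_subspace G n \<rho> W"
    and proper: "W \<noteq> carrier_vec n"
  shows "\<exists>k \<sigma>. k < n \<and> representation G k \<sigma> \<and>
    (\<forall>g\<in>carrier G. \<sigma> g = 1\<^sub>m k \<longrightarrow> (\<forall>w\<in>W. \<rho> g *\<^sub>v w = w))"
proof -
  note c = representation_carrier[OF \<rho>]
  have W: "VectorSpace.subspace class_ring W (module_vec TYPE(complex) n)"
    using inv by (simp add: invariant_subspace_def)
  then obtain k P where P: "P \<in> carrier_mat n k" and img: "W = (\<lambda>v. P *\<^sub>v v) ` carrier_vec k"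
    and inj: "\<And>v. v \<in> carrier_vec k \<Longrightarrow> P *\<^sub>v v = 0\<^sub>v n \<Longrightarrow> v = 0\<^sub>v k"
    using subspace_is_range_of_injective_mat[OF W] by blast
  have cancel: "A = B" if A: "A \<in> carrier_mat k l" and B: "B \<in> carrier_mat k l" and eq: "P * A = P * B" for A B l
  proof (rule mat_col_eqI)
    fix j assume "j < dim_col B"
    then have j: "j < l" using B by simp
    have "P *\<^sub>v col A j = P *\<^sub>v col B j"
      using col_mult2[OF P A j] col_mult2[OF P B j] eq by metis
    then have "P *\<^sub>v (col A j - col B j) = 0\<^sub>v n"
      using A B P j by (simp add: mult_minus_distrib_mat_vec[of _ n k] col_dim)
    then have "col A j - col B j = 0\<^sub>v k" using A B j by (intro inj) auto
    show "col A j = col B j"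
    proof (rule eq_vecI)
      fix i assume "i < dim_vec (col B j)"
      then have "i < k" using B by simp
      then show "col A j $ i = col B j $ i"
        using arg_cong[OF \<open>col A j - col B j = 0\<^sub>v k\<close>, of "\<lambda>v. v $ i"] A B j by simp
    qed (use A B in auto)
  qed (use A B in auto)
  have "\<exists>S\<in>carrier_mat k k. \<rho> g * P = P * S" if g: "g \<in> carrier G" for g
  proof -
    have "\<exists>u\<in>carrier_vec k. \<rho> g *\<^sub>v col P j = P *\<^sub>v u" if "j < k" for j
    proof -
      have "P *\<^sub>v unit_vec k j \<in> W" unfolding img by simp
      moreover have "P *\<^sub>v unit_vec k j = col P j" using P that by (intro eq_vecI) auto
      ultimately have "\<rho> g *\<^sub>v col P j \<in> W" using inv g by (auto simp: invariant_subspace_def)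
      then show ?thesis unfolding img by auto
    qed
    then obtain u where u: "\<And>j. j < k \<Longrightarrow> u j \<in> carrier_vec k \<and> \<rho> g *\<^sub>v col P j = P *\<^sub>v u j" by metis
    define S where "S = mat k k (\<lambda>(i, j). u j $ i)"
    have S: "S \<in> carrier_mat k k" by (simp add: S_def)
    have colS: "col S j = u j" if "j < k" for j
      using that u[OF that] by (intro eq_vecI) (auto simp: S_def)
    have "\<rho> g * P = P * S"
    proof (rule mat_col_eqI)
      fix j assume "j < dim_col (P * S)"
      then have j: "j < k" using S by simp
      show "col (\<rho> g * P) j = col (P * S) j"
        using col_mult2[OF c[OF g] P j] col_mult2[OF P S j] u[OF j] colS[OF j] by metis
    qed (use S P c[OF g] in auto)
    with S show ?thesis by blast
  qed
  then obtain \<sigma> where \<sigma>: "\<And>g. g \<in> carrier G \<Longrightarrow> \<sigma> g \<in> carrier_mat k k \<and> \<rho> g * P = P * \<sigma> g" by metis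
  have rep: "representation G k \<sigma>"
    unfolding representation_iff
  proof (intro conjI ballI)
    show "\<sigma> g \<in> carrier_mat k k" if "g \<in> carrier G" for g using \<sigma> that by blast
    have "P * \<sigma> \<one> = P * 1\<^sub>m k" using \<sigma>[of "\<one>"] \<rho> P by simp
    from cancel[OF conjunct1[OF \<sigma>[OF one_closed]] one_carrier_mat this] show "\<sigma> \<one> = 1\<^sub>m k" .
    fix g h assume g: "g \<in> carrier G" and h: "h \<in> carrier G"
    have "P * \<sigma> (g \<otimes> h) = \<rho> g * \<rho> h * P" using \<sigma>[of "g \<otimes> h"] g h representation_mult[OF \<rho> g h] by auto
    also have "\<dots> = \<rho> g * (\<rho> h * P)" using c[OF g] c[OF h] P by (rule assoc_mult_mat)
    also have "\<dots> = \<rho> g * (P * \<sigma> h)" using \<sigma>[OF h] by simp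
    also have "\<dots> = \<rho> g * P * \<sigma> h" using c[OF g] P \<sigma>[OF h] by (intro assoc_mult_mat[symmetric]) auto
    also have "\<dots> = P * \<sigma> g * \<sigma> h" using \<sigma>[OF g] by simp
    also have "\<dots> = P * (\<sigma> g * \<sigma> h)" using P \<sigma>[OF g] \<sigma>[OF h] by (intro assoc_mult_mat) auto
    finally have "P * \<sigma> (g \<otimes> h) = P * (\<sigma> g * \<sigma> h)" .
    then show "\<sigma> (g \<otimes> h) = \<sigma> g * \<sigma> h"
      using cancel[of "\<sigma> (g \<otimes> h)" k "\<sigma> g * \<sigma> h"] mult_carrier_mat[of "\<sigma> g" k k "\<sigma> h" k]
        \<sigma>[OF g] \<sigma>[OF h] \<sigma>[of "g \<otimes> h"] g h by blast
  qed
  have "k \<noteq> n"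
  proof
    assume kn: "k = n"
    \<comment> \<open>A square injective \<open>P\<close> would be invertible, so its range
      \<open>W\<close> would be the whole space.\<close>
    have "det P \<noteq> 0" using det_0_iff_vec_prod_zero[of P n] P inj unfolding kn by blast
    then obtain Q where Q: "Q \<in> carrier_mat n n" "P * Q = 1\<^sub>m n"
      using det_non_zero_imp_unit[of P n "()"] P unfolding kn by (auto simp: Units_def ring_mat_simps)
    have "w \<in> W" if w: "w \<in> carrier_vec n" for w
    proof -
      have "w = (P * Q) *\<^sub>v w" using Q w by simp
      also have "\<dots> = P *\<^sub>v (Q *\<^sub>v w)" using P Q w unfolding kn by (intro assoc_mult_mat_vec) auto
      finally show ?thesis unfolding img kn using Q w by auto
    qed
    then show False using proper W by (auto simp: subspace_vec_iff)
  qed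
  with injective_mat_dim_le[OF P inj] have "k < n" by simp
  moreover have "\<rho> g *\<^sub>v w = w" if g: "g \<in> carrier G" "\<sigma> g = 1\<^sub>m k" and w: "w \<in> W" for g w
  proof -
    obtain v where v: "v \<in> carrier_vec k" "w = P *\<^sub>v v" using w unfolding img by blast
    have "\<rho> g *\<^sub>v (P *\<^sub>v v) = (\<rho> g * P) *\<^sub>v v" using c[OF g(1)] P v by (intro assoc_mult_mat_vec[symmetric])
    also have "\<dots> = P *\<^sub>v v" using \<sigma>[OF g(1)] g(2) P by simp
    finally show ?thesis using v by simp
  qed
  ultimately show ?thesis using rep by blast
qed

text \<open>In a representation of minimal dimension on which \<open>D\<close> acts nontrivially, every proper invariant
  subspace is fixed pointwise by \<open>D\<close>. Applied to the kernel of the sum over \<open>D\<close>, this shows that the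
  sum vanishes, so \<open>D\<close> has no nonzero fixed vectors and the representation is irreducible.\<close>

lemma exists_irreducible_nontrivial:
  assumes D: "D \<lhd> G" and nontriv: "D \<noteq> {\<one>}"
  shows "\<exists>n \<rho>. irreducible_representation G n \<rho> \<and> (\<exists>d\<in>D. \<rho> d \<noteq> 1\<^sub>m n)"
proof -
  have DG: "d \<in> carrier G" if "d \<in> D" for d using that normal_imp_subgroup[OF D] subgroup.mem_carrier by metis
  have D1: "\<one> \<in> D" using normal_imp_subgroup[OF D] by (rule subgroup.one_closed)
  have finD: "finite D" using DG fin by (meson finite_subset subsetI)
  define acts where "acts n \<rho> \<longleftrightarrow> representation G n \<rho> \<and> (\<exists>d\<in>D. \<rho> d \<noteq> 1\<^sub>m n)" for n \<rho>
  have "\<exists>n \<rho>. acts n \<rho>"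
  proof -
    obtain d where "d \<in> D" "d \<noteq> \<one>" using nontriv D1 by blast
    then show ?thesis using exists_faithful_representation DG unfolding acts_def by metis
  qed
  then obtain n where "\<exists>\<rho>. acts n \<rho>" and min: "\<And>k \<sigma>. k < n \<Longrightarrow> \<not> acts k \<sigma>"
    using exists_least_iff[of "\<lambda>n. \<exists>\<rho>. acts n \<rho>"] by auto
  then obtain \<rho> d0 where \<rho>: "representation G n \<rho>" and d0: "d0 \<in> D" "\<rho> d0 \<noteq> 1\<^sub>m n"
    by (auto simp: acts_def)
  note c = representation_carrier[OF \<rho>]
  have act_mult: "\<rho> (g \<otimes> h) *\<^sub>v v = \<rho> g *\<^sub>v (\<rho> h *\<^sub>v v)"
    if "g \<in> carrier G" "h \<in> carrier G" "v \<in> carrier_vec n" for g h v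
    using that c[OF that(1)] c[OF that(2)] by (simp add: representation_mult[OF \<rho>] assoc_mult_mat_vec[of _ n n _ n])
  have act_carrier: "\<rho> g *\<^sub>v v \<in> carrier_vec n" if "g \<in> carrier G" "v \<in> carrier_vec n" for g v
    using c[OF that(1)] that(2) by (rule mult_mat_vec_carrier)
  have fixed: "\<rho> d *\<^sub>v w = w"
    if W: "invariant_subspace G n \<rho> W" "W \<noteq> carrier_vec n" and d: "d \<in> D" and w: "w \<in> W" for W d w
  proof -
    obtain k \<sigma> where \<sigma>: "k < n" "representation G k \<sigma>"
      "\<forall>g\<in>carrier G. \<sigma> g = 1\<^sub>m k \<longrightarrow> (\<forall>w\<in>W. \<rho> g *\<^sub>v w = w)"
      using subrepresentation[OF \<rho> W] by blast
    \<comment> \<open>By minimality of \<open>n\<close> the whole of \<open>D\<close> acts trivially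
      in the smaller dimension \<open>k\<close>.\<close>
    then have "\<sigma> d = 1\<^sub>m k" using min[OF \<sigma>(1), of \<sigma>] d unfolding acts_def by blast
    then show ?thesis using \<sigma>(3) d w DG by blast
  qed
  define S where "S v = vec n (\<lambda>i. \<Sum>d\<in>D. (\<rho> d *\<^sub>v v) $ i)" for v
  have S_carrier: "S v \<in> carrier_vec n" for v by (simp add: S_def)
  have zero: "A *\<^sub>v 0\<^sub>v n = 0\<^sub>v n" if "A \<in> carrier_mat n n" for A :: "complex mat"
    using that by (auto intro!: eq_vecI)
  have S_add: "S (v + w) = S v + S w" if v: "v \<in> carrier_vec n" and w: "w \<in> carrier_vec n" for v w
  proof (rule eq_vecI)
    fix i assume "i < dim_vec (S v + S w)"
    then have i: "i < n" by (simp add: S_def)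
    have "(\<rho> d *\<^sub>v (v + w)) $ i = (\<rho> d *\<^sub>v v) $ i + (\<rho> d *\<^sub>v w) $ i" if d: "d \<in> D" for d
      using mult_add_distrib_mat_vec[OF c[OF DG[OF d]] v w] c[OF DG[OF d]] i by simp
    then show "S (v + w) $ i = (S v + S w) $ i" using i by (simp add: S_def sum.distrib)
  qed (simp add: S_def)
  have S_smult: "S (a \<cdot>\<^sub>v v) = a \<cdot>\<^sub>v S v" if v: "v \<in> carrier_vec n" for a v
  proof (rule eq_vecI)
    fix i assume "i < dim_vec (a \<cdot>\<^sub>v S v)"
    then have i: "i < n" by (simp add: S_def)
    have "(\<rho> d *\<^sub>v (a \<cdot>\<^sub>v v)) $ i = a * (\<rho> d *\<^sub>v v) $ i" if d: "d \<in> D" for d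
      using mult_mat_vec[OF c[OF DG[OF d]] v] c[OF DG[OF d]] i by simp
    then show "S (a \<cdot>\<^sub>v v) $ i = (a \<cdot>\<^sub>v S v) $ i" using i by (simp add: S_def sum_distrib_left)
  qed (simp add: S_def)
  have S_zero: "S (0\<^sub>v n) = 0\<^sub>v n"
    using zero[OF c[OF DG]] by (intro eq_vecI) (simp_all add: S_def)
  have S_fixed: "S v = of_nat (card D) \<cdot>\<^sub>v v"
    if "v \<in> carrier_vec n" "\<And>d. d \<in> D \<Longrightarrow> \<rho> d *\<^sub>v v = v" for v
    using that by (intro eq_vecI) (auto simp: S_def)
  have entry: "(A *\<^sub>v u) $ i = (\<Sum>j<n. A $$ (i, j) * u $ j)"
    if "A \<in> carrier_mat n n" "u \<in> carrier_vec n" "i < n" for A :: "complex mat" and u i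
    using that by (auto simp: scalar_prod_def atLeast0LessThan intro!: sum.cong)
  have S_conj: "S (\<rho> g *\<^sub>v v) = \<rho> g *\<^sub>v S v" if g: "g \<in> carrier G" and v: "v \<in> carrier_vec n" for g v
  proof (rule eq_vecI)
    fix i assume "i < dim_vec (\<rho> g *\<^sub>v S v)"
    then have i: "i < n" using c[OF g] by simp
    have conjD: "g \<otimes> d \<otimes> inv g \<in> D" "inv g \<otimes> d \<otimes> g \<in> D" if "d \<in> D" for d
      using that g normal.inv_op_closed2[OF D] normal.inv_op_closed1[OF D] by auto
    have cancel: "g \<otimes> (inv g \<otimes> x) = x" "inv g \<otimes> (g \<otimes> x) = x" if "x \<in> carrier G" for x
      using g that by (simp_all add: m_assoc[symmetric])
    have "S (\<rho> g *\<^sub>v v) $ i = (\<Sum>d\<in>D. (\<rho> (d \<otimes> g) *\<^sub>v v) $ i)"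
      using i g v DG by (simp add: S_def act_mult)
    \<comment> \<open>Normality enters here: conjugation by \<open>g\<close> permutes
      \<open>D\<close>, so \<open>S\<close> commutes with the group and its kernel is
      invariant.\<close>
    also have "\<dots> = (\<Sum>d\<in>D. (\<rho> (g \<otimes> d) *\<^sub>v v) $ i)"
      by (rule sum.reindex_bij_witness[where i = "\<lambda>d. g \<otimes> d \<otimes> inv g" and j = "\<lambda>d. inv g \<otimes> d \<otimes> g"])
        (use conjD DG g in \<open>auto simp: m_assoc cancel\<close>)
    also have "\<dots> = (\<Sum>d\<in>D. (\<rho> g *\<^sub>v (\<rho> d *\<^sub>v v)) $ i)"
      using g v DG by (intro sum.cong) (auto simp: act_mult)
    also have "\<dots> = (\<Sum>d\<in>D. \<Sum>j<n. \<rho> g $$ (i, j) * (\<rho> d *\<^sub>v v) $ j)"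
      using entry[OF c[OF g] act_carrier[OF DG v] i] by simp
    also have "\<dots> = (\<Sum>j<n. \<rho> g $$ (i, j) * S v $ j)"
      by (subst sum.swap) (simp add: S_def sum_distrib_left)
    also have "\<dots> = (\<rho> g *\<^sub>v S v) $ i"
      using entry[OF c[OF g] S_carrier i] by simp
    finally show "S (\<rho> g *\<^sub>v v) $ i = (\<rho> g *\<^sub>v S v) $ i" .
  qed (use c[OF g] S_carrier in \<open>auto simp: S_def\<close>)
  have S_act: "S (\<rho> d *\<^sub>v v) = S v" if d: "d \<in> D" and v: "v \<in> carrier_vec n" for d v
  proof (rule eq_vecI)
    fix i assume "i < dim_vec (S v)"
    then have i: "i < n" by (simp add: S_def)
    have "S (\<rho> d *\<^sub>v v) $ i = (\<Sum>e\<in>D. (\<rho> (e \<otimes> d) *\<^sub>v v) $ i)"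
      using i d v DG by (simp add: S_def act_mult)
    also have "\<dots> = (\<Sum>e\<in>D. (\<rho> e *\<^sub>v v) $ i)"
      by (rule sum.reindex_bij_witness[where i = "\<lambda>e. e \<otimes> inv d" and j = "\<lambda>e. e \<otimes> d"])
        (use d DG normal_imp_subgroup[OF D] in \<open>auto simp: m_assoc subgroup.m_closed subgroup.m_inv_closed\<close>)
    finally show "S (\<rho> d *\<^sub>v v) $ i = S v $ i" using i by (simp add: S_def)
  qed (simp add: S_def)
  let ?ker = "{v \<in> carrier_vec n. S v = 0\<^sub>v n}"
  have ker_inv: "invariant_subspace G n \<rho> ?ker"
    unfolding invariant_subspace_def subspace_vec_iff
    using S_add S_smult S_zero S_conj act_carrier zero[OF c] by auto
  have fixed_0: "v = 0\<^sub>v n" if v: "v \<in> ?ker" "\<And>d. d \<in> D \<Longrightarrow> \<rho> d *\<^sub>v v = v" for v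
  proof -
    have "of_nat (card D) \<cdot>\<^sub>v v = 0\<^sub>v n" using v S_fixed[of v] by auto
    moreover have "card D > 0" using D1 finD by (auto simp: card_gt_0_iff)
    ultimately show ?thesis
      using v(1) by (intro eq_vecI) (auto dest: arg_cong[where f = "\<lambda>u. u $ _"] simp: vec_eq_iff)
  qed
  have ker: "?ker = carrier_vec n"
  proof (rule ccontr)
    assume proper: "?ker \<noteq> carrier_vec n"
    \<comment> \<open>A proper kernel would be fixed by \<open>D\<close>, so \<open>S\<close> would
      multiply it by \<open>card D\<close> and also kill it. As \<open>S\<close> also kills every
      difference of \<open>\<rho> d0 *\<^sub>v v\<close> and \<open>v\<close>, the element
      \<open>d0\<close> would then act trivially.\<close>
    have ker0: "v = 0\<^sub>v n" if "v \<in> ?ker" for v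
      using fixed_0[OF that] fixed[OF ker_inv proper _ that] by blast
    have d0_fixed: "\<rho> d0 *\<^sub>v v = v" if v: "v \<in> carrier_vec n" for v
    proof -
      have r: "\<rho> d0 *\<^sub>v v \<in> carrier_vec n" using act_carrier[OF DG[OF d0(1)] v] .
      have "S (\<rho> d0 *\<^sub>v v + (- 1) \<cdot>\<^sub>v v) = S v + (- 1) \<cdot>\<^sub>v S v"
        using S_add[OF r, of "(- 1) \<cdot>\<^sub>v v"] S_smult[OF v] S_act[OF d0(1) v] v by simp
      also have "\<dots> = 0\<^sub>v n" using S_carrier[of v] by (intro eq_vecI) auto
      finally have "\<rho> d0 *\<^sub>v v + (- 1) \<cdot>\<^sub>v v = 0\<^sub>v n" using r v by (intro ker0) auto
      then have "(\<rho> d0 *\<^sub>v v + (- 1) \<cdot>\<^sub>v v) $ i = 0" if "i < n" for i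
        using that by simp
      moreover have "(\<rho> d0 *\<^sub>v v + (- 1) \<cdot>\<^sub>v v) $ i = (\<rho> d0 *\<^sub>v v) $ i - v $ i" if "i < n" for i
        using that r v by simp
      ultimately show ?thesis using c[OF DG[OF d0(1)]] v by (intro eq_vecI) auto
    qed
    have "\<rho> d0 = 1\<^sub>m n"
    proof (rule mat_col_eqI)
      fix j assume "j < dim_col (1\<^sub>m n :: complex mat)"
      then have j: "j < n" by simp
      have "col (\<rho> d0) j = \<rho> d0 *\<^sub>v unit_vec n j"
        using c[OF DG[OF d0(1)]] j by (intro eq_vecI) auto
      then show "col (\<rho> d0) j = col (1\<^sub>m n) j" using d0_fixed[of "unit_vec n j"] j by simp
    qed (use c[OF DG[OF d0(1)]] in auto)
    with d0 show False by simp
  qed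
  have "W = {0\<^sub>v n} \<or> W = carrier_vec n" if W: "invariant_subspace G n \<rho> W" for W
  proof (cases "W = carrier_vec n")
    case False
    have Ws: "W \<subseteq> carrier_vec n" "0\<^sub>v n \<in> W" using W by (auto simp: invariant_subspace_def subspace_vec_iff)
    have "w = 0\<^sub>v n" if "w \<in> W" for w
      using fixed_0[of w] fixed[OF W False _ that] Ws(1) that ker by blast
    then show ?thesis using Ws(2) by blast
  qed simp
  moreover have "n > 0"
  proof (rule ccontr)
    assume "\<not> n > 0"
    then have "\<rho> d0 = 1\<^sub>m n" using c[OF DG[OF d0(1)]] by (intro eq_matI) auto
    with d0 show False by simp
  qed
  ultimately show ?thesis using \<rho> d0 unfolding irreducible_representation_def by blast
qed

text \<open>If the common kernel of the linear characters were nontrivial, some irreducible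
  representation would be nontrivial on it; being linear by hypothesis, it is trivial there. So this
  kernel, which contains all commutators, is trivial.\<close>

lemma comm_if_all_linear:
  assumes lin: "Irr G \<subseteq> Lin" and x: "x \<in> carrier G" and y: "y \<in> carrier G"
  shows "x \<otimes> y = y \<otimes> x"
proof -
  let ?D = "common_kernel Lin"
  have D: "?D \<lhd> G" by (rule common_kernel_normal) simp
  have "?D = {\<one>}"
  proof (rule ccontr)
    assume "?D \<noteq> {\<one>}"
    then obtain n \<rho> d where irr: "irreducible_representation G n \<rho>" and d: "d \<in> ?D" "\<rho> d \<noteq> 1\<^sub>m n"
      using exists_irreducible_nontrivial[OF D] by blast
    note \<rho> = irreducible_representationD(1)[OF irr]
    have \<chi>: "character G \<rho> \<in> Lin" using lin irr unfolding Irr_def by blast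
    have dG: "d \<in> carrier G" and "character G \<rho> d = 1" using d \<chi> by (auto simp: common_kernel_def)
    moreover have "n = 1" using character_one[OF \<rho>] Lin_one[OF \<chi>] by simp
    ultimately have "\<rho> d $$ (0, 0) = 1" and "\<rho> d \<in> carrier_mat 1 1"
      using representation_carrier[OF \<rho> dG] by (auto simp: character_apply mat_trace_def)
    then have "\<rho> d = 1\<^sub>m 1" by (intro eq_matI) auto
    with d \<open>n = 1\<close> show False by simp
  qed
  moreover have "x \<otimes> y \<otimes> inv (y \<otimes> x) \<in> ?D"
  proof -
    have "\<mu> (x \<otimes> y \<otimes> inv (y \<otimes> x)) = 1" if \<mu>: "\<mu> \<in> Lin" for \<mu>
    proof -
      have "\<mu> (x \<otimes> y \<otimes> inv (y \<otimes> x)) = \<mu> (x \<otimes> y) * cnj (\<mu> (y \<otimes> x))"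
        using x y by (simp add: Lin_mult[OF \<mu>, of "x \<otimes> y"] Lin_inverse[OF \<mu>])
      also have "\<mu> (y \<otimes> x) = \<mu> (x \<otimes> y)" using x y by (simp add: Lin_mult[OF \<mu>])
      finally show ?thesis using Lin_inv[OF \<mu>, of "x \<otimes> y"] x y by simp
    qed
    then show ?thesis using x y by (simp add: common_kernel_def)
  qed
  ultimately have "x \<otimes> y \<otimes> inv (y \<otimes> x) = \<one>" by blast
  then show ?thesis using x y by (metis inv_closed inv_equality inv_inv m_closed)
qed

theorem supersolvable_if_few_zeros:
  assumes "2 * nz G < card (Irr G)"
  shows "supersolvable G"
proof (cases "Irr G \<subseteq> Lin")
  case True
  then show ?thesis using comm_if_all_linear by (intro supersolvable_if_comm fin)
next
  case False
  then obtain \<chi> where \<chi>: "\<chi> \<in> Irr G - Lin" by blast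
  show ?thesis
    using single_zero_class_supersolvable[OF \<chi> few_zeros_nonlinear[OF assms \<chi>]] .
qed

end

theorem theoremC:
  fixes G :: "('a, 'b) monoid_scheme"
  assumes "group G" and "finite (carrier G)"
    and "anz G < 1 / 2"
  shows "supersolvable G"
proof -
  interpret fin_group G
    using assms(1,2) by (simp add: fin_group_def fin_group_axioms_def)
  \<comment> \<open>Division by zero is 0 in HOL, so the denominator of \<open>anz G\<close> must be
    known to be positive before clearing it.\<close>
  have "card (Irr G) > 0"
    using finite_Irr trivial_Lin Lin_Irr by (auto simp: card_gt_0_iff)
  then have "real (2 * nz G) < real (card (Irr G))"
    using assms(3) by (simp add: anz_def field_simps)
  then show ?thesis
    using supersolvable_if_few_zeros unfolding of_nat_less_iff by blast
qed

end
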